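(* Let $D$ be a finite-dimensional central division algebra over a field $F$, let $R$ be a commutative $F$-algebra, let $D_R=D\otimes_F R$ and let $n$ be a positive integer. Every semiprime submodule $N$ of the left $D_R$-module $M=(D_R)^n$ satisfies $$N=\bigcap_P K(N,P)$$ where $P$ runs through all two-sided prime ideals $P\neq D_R$ of $D_R$. We can omit $P$ from the intersection if $K(N,P)=M$, which holds if and only if $P\not\supseteq(N:M)$.
   Context: Let $A$ be an associative ring with $1$ (here $A=D_R$) and $M=A^n$ as a left $A$-module. For a submodule $N$ of $M$, $(N:M):=\{a\in A\mid aM\subseteq N\}$, a two-sided ideal of $A$. A two-sided ideal $P$ of $A$ is prime if $xAy\subseteq P$ implies $x\in P$ or $y\in P$. A submodule $N$ of $M$ is semiprime if for every $\mathbf{f}=(f_1,\ldots,f_n)\in M$ such that $f_iA\mathbf{f}\subseteq N$ for all $i$ we have $\mathbf{f}\in N$. A submodule $N$ of $M$ is prime if for every $a\in A$ and $\mathbf{m}\in M$ such that $aA\mathbf{m}\subseteq N$ we have $a\in(N:M)$ or $\mathbf{m}\in N$. For a two-sided prime ideal $P$, a prime submodule $N$ with $(N:M)=P$ is called $P$-prime. An intersection of $P$-prime submodules is $P$-prime. $K(N,P)$ denotes the smallest $P$-prime submodule of $M$ containing $N$ if some $P$-prime submodule contains $N$, and $K(N,P)=M$ otherwise. The intersection of the empty family of submodules of $M$ is $M$. *)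

theory Defs
  imports "HOL-Algebra.Algebra"
begin

section \<open>Finite-dimensional central division algebras\<close>

text \<open>The library locale \<^locale>\<open>algebra\<close> covers commutative algebras only.\<close>

locale assoc_algebra = module F D + ring D for F (structure) and D (structure) +
  assumes smult_mult_left:
      "\<lbrakk>a \<in> carrier F; x \<in> carrier D; y \<in> carrier D\<rbrakk> \<Longrightarrow>
        (a \<odot>\<^bsub>D\<^esub> x) \<otimes>\<^bsub>D\<^esub> y = a \<odot>\<^bsub>D\<^esub> (x \<otimes>\<^bsub>D\<^esub> y)"
    and smult_mult_right:
      "\<lbrakk>a \<in> carrier F; x \<in> carrier D; y \<in> carrier D\<rbrakk> \<Longrightarrow>
        x \<otimes>\<^bsub>D\<^esub> (a \<odot>\<^bsub>D\<^esub> y) = a \<odot>\<^bsub>D\<^esub> (x \<otimes>\<^bsub>D\<^esub> y)"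

definition scalars :: "('f, 'p) ring_scheme \<Rightarrow> ('f, 'd, 'q) module_scheme \<Rightarrow> 'd set" where
  "scalars F D = (\<lambda>a. a \<odot>\<^bsub>D\<^esub> \<one>\<^bsub>D\<^esub>) ` carrier F"

definition ring_center :: "('a, 'p) ring_scheme \<Rightarrow> 'a set" where
  "ring_center A = {z \<in> carrier A. \<forall>x\<in>carrier A. z \<otimes>\<^bsub>A\<^esub> x = x \<otimes>\<^bsub>A\<^esub> z}"

text \<open>Dimension over \<open>F\<close> is dimension over the subfield \<open>scalars F D\<close> of \<open>D\<close>,
  which is isomorphic to \<open>F\<close> because \<open>D\<close> is not the zero ring.\<close>

locale fin_dim_central_division_algebra = assoc_algebra F D + F: field F
  for F (structure) and D (structure) +
  assumes nontrivial: "\<one>\<^bsub>D\<^esub> \<noteq> \<zero>\<^bsub>D\<^esub>"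
    and division: "carrier D - {\<zero>\<^bsub>D\<^esub>} \<subseteq> Units D"
    and central: "ring_center D = scalars F D"
    and finite_dim: "ring.finite_dimension D (scalars F D) (carrier D)"

section \<open>The tensor product of two algebras\<close>

text \<open>The integral monoid ring of \<open>G\<close>; its additive group is the free abelian group on \<open>G\<close>,
  and multiplication is the biadditive extension of that of \<open>G\<close>.\<close>

definition int_monoid_ring :: "('g, 'm) monoid_scheme \<Rightarrow> ('g \<Rightarrow>\<^sub>0 int) ring" where
  "int_monoid_ring G =
    \<lparr>carrier = carrier (free_Abelian_group (carrier G)),
     monoid.mult = (\<lambda>x y. frag_extend (\<lambda>g. frag_extend (\<lambda>h. frag_of (g \<otimes>\<^bsub>G\<^esub> h)) y) x),
     monoid.one = frag_of \<one>\<^bsub>G\<^esub>, ring.zero = 0, ring.add = (+)\<rparr>"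

inductive_set tensor_relations ::
    "('f, 'p) ring_scheme \<Rightarrow> ('f, 'd, 'q) module_scheme \<Rightarrow> ('f, 'r, 's) module_scheme
      \<Rightarrow> ('d \<times> 'r \<Rightarrow>\<^sub>0 int) set"
  for F D R where
    add_left: "\<lbrakk>d \<in> carrier D; d' \<in> carrier D; r \<in> carrier R\<rbrakk> \<Longrightarrow>
      frag_of (d \<oplus>\<^bsub>D\<^esub> d', r) - frag_of (d, r) - frag_of (d', r) \<in> tensor_relations F D R"
  | add_right: "\<lbrakk>d \<in> carrier D; r \<in> carrier R; r' \<in> carrier R\<rbrakk> \<Longrightarrow>
      frag_of (d, r \<oplus>\<^bsub>R\<^esub> r') - frag_of (d, r) - frag_of (d, r') \<in> tensor_relations F D R"
  | balanced: "\<lbrakk>a \<in> carrier F; d \<in> carrier D; r \<in> carrier R\<rbrakk> \<Longrightarrow>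
      frag_of (a \<odot>\<^bsub>D\<^esub> d, r) - frag_of (d, a \<odot>\<^bsub>R\<^esub> r) \<in> tensor_relations F D R"

text \<open>The usual quotient of the free abelian group on \<open>D \<times> R\<close> by the subgroup generated by the
  relations. That subgroup is an ideal, so the quotient carries the multiplication
  \<open>(d \<otimes> r)(d' \<otimes> r') = dd' \<otimes> rr'\<close>; see \<open>ideal_tensor_ideal\<close> below.\<close>

definition tensor_ideal ::
    "('f, 'p) ring_scheme \<Rightarrow> ('f, 'd, 'q) module_scheme \<Rightarrow> ('f, 'r, 's) module_scheme
      \<Rightarrow> ('d \<times> 'r \<Rightarrow>\<^sub>0 int) set" where
  "tensor_ideal F D R =
    generate (add_monoid (int_monoid_ring (D \<times>\<times> R))) (tensor_relations F D R)"

definition tensor_algebra ::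
    "('f, 'p) ring_scheme \<Rightarrow> ('f, 'd, 'q) module_scheme \<Rightarrow> ('f, 'r, 's) module_scheme
      \<Rightarrow> ('d \<times> 'r \<Rightarrow>\<^sub>0 int) set ring" where
  "tensor_algebra F D R = int_monoid_ring (D \<times>\<times> R) Quot tensor_ideal F D R"

lemma int_monoid_ring_simps [simp]:
  "carrier (int_monoid_ring G) = {c. Poly_Mapping.keys c \<subseteq> carrier G}"
  "x \<otimes>\<^bsub>int_monoid_ring G\<^esub> y =
     frag_extend (\<lambda>g. frag_extend (\<lambda>h. frag_of (g \<otimes>\<^bsub>G\<^esub> h)) y) x"
  "\<one>\<^bsub>int_monoid_ring G\<^esub> = frag_of \<one>\<^bsub>G\<^esub>"
  "\<zero>\<^bsub>int_monoid_ring G\<^esub> = 0"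
  "x \<oplus>\<^bsub>int_monoid_ring G\<^esub> y = x + y"
  by (simp_all add: int_monoid_ring_def free_Abelian_group_def)

lemma frag_extend_fun_diff: "frag_extend (\<lambda>g. u g - v g) x = frag_extend u x - frag_extend v x"
proof -
  have "Poly_Mapping.keys x \<subseteq> UNIV" by simp
  then show ?thesis
    by (induction x rule: frag_induction) (auto simp: frag_extend_diff)
qed

lemma frag_extend_fun_add: "frag_extend (\<lambda>g. u g + v g) x = frag_extend u x + frag_extend v x"
proof -
  have "Poly_Mapping.keys x \<subseteq> UNIV" by simp
  then show ?thesis
    by (induction x rule: frag_induction) (auto simp: frag_extend_diff)
qed

lemma int_monoid_ring_mult_closed:
  assumes "monoid G" "Poly_Mapping.keys x \<subseteq> carrier G" "Poly_Mapping.keys y \<subseteq> carrier G"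
  shows "Poly_Mapping.keys (frag_extend (\<lambda>g. frag_extend (\<lambda>h. frag_of (g \<otimes>\<^bsub>G\<^esub> h)) y) x)
    \<subseteq> carrier G"
proof -
  interpret monoid G by fact
  have "Poly_Mapping.keys (frag_extend (\<lambda>h. frag_of (g \<otimes>\<^bsub>G\<^esub> h)) y) \<subseteq> carrier G"
    if "g \<in> carrier G" for g
    using assms(3) that by (intro order_trans[OF keys_frag_extend]) (auto simp: keys_frag_of)
  then show ?thesis
    using assms(2) by (intro order_trans[OF keys_frag_extend]) blast
qed

lemma ring_int_monoid_ring:
  assumes "monoid G"
  shows "ring (int_monoid_ring G)"
proof (rule ringI)
  interpret monoid G by fact
  let ?m = "\<lambda>x y. frag_extend (\<lambda>g. frag_extend (\<lambda>h. frag_of (g \<otimes>\<^bsub>G\<^esub> h)) y) x"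
  show "abelian_group (int_monoid_ring G)"
  proof (rule abelian_groupI)
    fix x assume "x \<in> carrier (int_monoid_ring G)"
    then show "\<exists>y\<in>carrier (int_monoid_ring G).
        y \<oplus>\<^bsub>int_monoid_ring G\<^esub> x = \<zero>\<^bsub>int_monoid_ring G\<^esub>"
      by (intro bexI[of _ "- x"]) auto
  qed (auto simp: add_ac dest!: subsetD[OF keys_add])
  show "Group.monoid (int_monoid_ring G)"
  proof (rule monoidI)
    fix x y z
    assume "x \<in> carrier (int_monoid_ring G)" "y \<in> carrier (int_monoid_ring G)"
      "z \<in> carrier (int_monoid_ring G)"
    then have x: "Poly_Mapping.keys x \<subseteq> carrier G" and y: "Poly_Mapping.keys y \<subseteq> carrier G"
      and z: "Poly_Mapping.keys z \<subseteq> carrier G" by auto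
    from x have "?m (?m x y) z = ?m x (?m y z)"
    proof (induction x rule: frag_induction)
      case (one g)
      from y show ?case
      proof (induction y rule: frag_induction)
        case (one h)
        from z show ?case
          by (induction z rule: frag_induction)
            (use \<open>g \<in> carrier G\<close> \<open>h \<in> carrier G\<close> in \<open>auto simp: frag_extend_diff m_assoc\<close>)
      qed (auto simp: frag_extend_diff)
    qed (auto simp: frag_extend_diff)
    then show "x \<otimes>\<^bsub>int_monoid_ring G\<^esub> y \<otimes>\<^bsub>int_monoid_ring G\<^esub> z
      = x \<otimes>\<^bsub>int_monoid_ring G\<^esub> (y \<otimes>\<^bsub>int_monoid_ring G\<^esub> z)" by simp
  next
    fix x assume "x \<in> carrier (int_monoid_ring G)"
    then have x: "Poly_Mapping.keys x \<subseteq> carrier G" by simp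
    from x have "?m (frag_of \<one>\<^bsub>G\<^esub>) x = x"
      by (induction x rule: frag_induction) (auto simp: frag_extend_diff)
    then show "\<one>\<^bsub>int_monoid_ring G\<^esub> \<otimes>\<^bsub>int_monoid_ring G\<^esub> x = x" by simp
    from x have "?m x (frag_of \<one>\<^bsub>G\<^esub>) = x"
      by (induction x rule: frag_induction) (auto simp: frag_extend_diff)
    then show "x \<otimes>\<^bsub>int_monoid_ring G\<^esub> \<one>\<^bsub>int_monoid_ring G\<^esub> = x" by simp
  qed (use int_monoid_ring_mult_closed[OF assms] in \<open>auto simp: keys_frag_of\<close>)
qed (auto simp: frag_extend_add frag_extend_fun_add)

lemma ideal_tensor_ideal:
  fixes D :: "('f, 'd, 'q) module_scheme" and R :: "('f, 'r, 's) module_scheme"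
  assumes "assoc_algebra F D" "algebra F R"
  shows "ideal (tensor_ideal F D R) (int_monoid_ring (D \<times>\<times> R))"
proof -
  interpret DR: ring D using assms(1) by (simp add: assoc_algebra_def)
  interpret RR: cring R using assms(2) by (rule algebra.M_cring)
  interpret D: assoc_algebra F D by fact
  interpret R: algebra F R by fact
  let ?Z = "int_monoid_ring (D \<times>\<times> R)" and ?I = "tensor_ideal F D R"
  have mon: "monoid (D \<times>\<times> R)"
    by (rule DirProd_monoid) (rule DR.monoid_axioms, rule RR.monoid_axioms)
  interpret Z: ring ?Z by (rule ring_int_monoid_ring) (rule mon)
  have relc: "tensor_relations F D R \<subseteq> carrier ?Z"
  proof
    fix x assume "x \<in> tensor_relations F D R"
    then show "x \<in> carrier ?Z"
      by cases (auto simp: keys_frag_of dest!: subsetD[OF keys_diff] split: if_splits)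
  qed
  have sub: "subgroup ?I (add_monoid ?Z)"
    unfolding tensor_ideal_def by (rule Z.add.generate_is_subgroup) (use relc in simp)
  have neg: "inv\<^bsub>add_monoid ?Z\<^esub> x = - x" if "x \<in> carrier ?Z" for x
  proof -
    have "\<ominus>\<^bsub>?Z\<^esub> x = - x"
      by (rule Z.minus_equality) (use that in auto)
    then show ?thesis by (simp add: a_inv_def)
  qed
  have sub_c: "x \<in> carrier ?Z" if "x \<in> ?I" for x
    using subgroup.subset[OF sub] that by auto
  have zero_I: "0 \<in> ?I" using subgroup.one_closed[OF sub] by simp
  have neg_I: "- x \<in> ?I" if "x \<in> ?I" for x
    using subgroup.m_inv_closed[OF sub that] neg[OF sub_c[OF that]] by simp
  have add_I: "x + y \<in> ?I" if "x \<in> ?I" "y \<in> ?I" for x y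
    using subgroup.m_closed[OF sub that] by simp
  have diff_I: "x - y \<in> ?I" if "x \<in> ?I" "y \<in> ?I" for x y
    using add_I[OF that(1) neg_I[OF that(2)]] by simp
  have rel_I: "x \<in> ?I" if "x \<in> tensor_relations F D R" for x
    using that unfolding tensor_ideal_def by (rule generate.incl)
  have rel_ops: "frag_of (e, s) \<otimes>\<^bsub>?Z\<^esub> x \<in> ?I \<and> x \<otimes>\<^bsub>?Z\<^esub> frag_of (e, s) \<in> ?I"
    if "x \<in> tensor_relations F D R" and e: "e \<in> carrier D" and s: "s \<in> carrier R" for x e s
    using that(1)
  proof cases
    case (add_left d d' r)
    show ?thesis
      using rel_I[OF tensor_relations.add_left[of "e \<otimes>\<^bsub>D\<^esub> d" D "e \<otimes>\<^bsub>D\<^esub> d'" "s \<otimes>\<^bsub>R\<^esub> r" R F]]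
        rel_I[OF tensor_relations.add_left[of "d \<otimes>\<^bsub>D\<^esub> e" D "d' \<otimes>\<^bsub>D\<^esub> e" "r \<otimes>\<^bsub>R\<^esub> s" R F]]
        add_left e s
      by (simp add: frag_extend_diff DirProd_def DR.l_distr DR.r_distr)
  next
    case (add_right d r r')
    show ?thesis
      using rel_I[OF tensor_relations.add_right[of "e \<otimes>\<^bsub>D\<^esub> d" D "s \<otimes>\<^bsub>R\<^esub> r" R "s \<otimes>\<^bsub>R\<^esub> r'" F]]
        rel_I[OF tensor_relations.add_right[of "d \<otimes>\<^bsub>D\<^esub> e" D "r \<otimes>\<^bsub>R\<^esub> s" R "r' \<otimes>\<^bsub>R\<^esub> s" F]]
        add_right e s
      by (simp add: frag_extend_diff DirProd_def RR.l_distr RR.r_distr)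
  next
    case (balanced a d r)
    have "s \<otimes>\<^bsub>R\<^esub> (a \<odot>\<^bsub>R\<^esub> r) = a \<odot>\<^bsub>R\<^esub> (s \<otimes>\<^bsub>R\<^esub> r)"
      using balanced s by (metis RR.m_comm R.smult_assoc2 R.smult_closed)
    then show ?thesis
      using rel_I[OF tensor_relations.balanced[of a F "e \<otimes>\<^bsub>D\<^esub> d" D "s \<otimes>\<^bsub>R\<^esub> r" R]]
        rel_I[OF tensor_relations.balanced[of a F "d \<otimes>\<^bsub>D\<^esub> e" D "r \<otimes>\<^bsub>R\<^esub> s" R]]
        balanced e s
      by (simp add: frag_extend_diff DirProd_def D.smult_mult_left D.smult_mult_right
          R.smult_assoc2)
  qed
  have gen_ops: "z \<otimes>\<^bsub>?Z\<^esub> x \<in> ?I \<and> x \<otimes>\<^bsub>?Z\<^esub> z \<in> ?I"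
    if x: "x \<in> tensor_relations F D R" and z: "z \<in> carrier ?Z" for x z
  proof -
    from z have "Poly_Mapping.keys z \<subseteq> carrier (D \<times>\<times> R)" by simp
    then show ?thesis
    proof (induction z rule: frag_induction)
      case (one g)
      then show ?case using rel_ops[OF x] by (cases g) (auto simp: DirProd_def)
    next
      case (diff u v)
      then show ?case using diff_I by (auto simp: frag_extend_diff frag_extend_fun_diff)
    qed (use zero_I in \<open>auto simp: frag_extend_eq_0\<close>)
  qed
  have ops: "z \<otimes>\<^bsub>?Z\<^esub> x \<in> ?I \<and> x \<otimes>\<^bsub>?Z\<^esub> z \<in> ?I"
    if x: "x \<in> ?I" and z: "z \<in> carrier ?Z" for x z
    using x[unfolded tensor_ideal_def]
  proof (induction x rule: generate.induct)
    case one
    then show ?case using zero_I z by (simp add: frag_extend_eq_0)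
  next
    case (incl h)
    then show ?case using gen_ops[OF _ z] by simp
  next
    case (inv h)
    then have "h \<in> carrier ?Z" using relc by blast
    then have "inv\<^bsub>add_monoid ?Z\<^esub> h = - h" by (rule neg)
    moreover have "frag_extend (\<lambda>g. - u g) w = - frag_extend u w"
      for u :: "'d \<times> 'r \<Rightarrow> 'd \<times> 'r \<Rightarrow>\<^sub>0 int" and w
      using frag_extend_fun_diff[of "\<lambda>_. 0" u w] by (simp add: frag_extend_eq_0)
    moreover have "- (z \<otimes>\<^bsub>?Z\<^esub> h) \<in> ?I" "- (h \<otimes>\<^bsub>?Z\<^esub> z) \<in> ?I"
      using gen_ops[OF inv z] neg_I by blast+
    ultimately show ?case by (simp add: frag_extend_minus)
  next
    case (eng h1 h2)
    then show ?case
      using add_I by (simp add: frag_extend_add frag_extend_fun_add)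
  qed
  show ?thesis
    by (rule idealI) (use Z.ring_axioms sub ops in auto)
qed

lemma ring_tensor_algebra:
  assumes "assoc_algebra F D" "algebra F R"
  shows "ring (tensor_algebra F D R)"
  unfolding tensor_algebra_def using ideal_tensor_ideal[OF assms] by (rule ideal.quotient_is_ring)

section \<open>Submodules of the left module \<open>A\<^sup>n\<close>\<close>

text \<open>The ring operations of the record are irrelevant. The locale \<^locale>\<open>submodule\<close>, unlike
  \<^locale>\<open>module\<close>, does not require the ring to be commutative.\<close>

definition power_module :: "('a, 'p) ring_scheme \<Rightarrow> nat \<Rightarrow> ('a, nat \<Rightarrow> 'a) module" where
  "power_module A n =
    \<lparr>carrier = {..<n} \<rightarrow>\<^sub>E carrier A,
     monoid.mult = undefined, monoid.one = undefined,
     ring.zero = (\<lambda>i\<in>{..<n}. \<zero>\<^bsub>A\<^esub>),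
     ring.add = (\<lambda>f g. \<lambda>i\<in>{..<n}. f i \<oplus>\<^bsub>A\<^esub> g i),
     smult = (\<lambda>a f. \<lambda>i\<in>{..<n}. a \<otimes>\<^bsub>A\<^esub> f i)\<rparr>"

definition colon ::
    "('a, 'p) ring_scheme \<Rightarrow> ('a, 'b, 'q) module_scheme \<Rightarrow> 'b set \<Rightarrow> 'a set" where
  "colon A M N = {a \<in> carrier A. \<forall>m\<in>carrier M. a \<odot>\<^bsub>M\<^esub> m \<in> N}"

text \<open>The whole ring and the whole module count as prime.\<close>

definition prime_two_sided_ideal :: "('a, 'p) ring_scheme \<Rightarrow> 'a set \<Rightarrow> bool" where
  "prime_two_sided_ideal A P \<longleftrightarrow> ideal P A \<and>
    (\<forall>x\<in>carrier A. \<forall>y\<in>carrier A.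
      (\<forall>a\<in>carrier A. x \<otimes>\<^bsub>A\<^esub> a \<otimes>\<^bsub>A\<^esub> y \<in> P) \<longrightarrow> x \<in> P \<or> y \<in> P)"

definition semiprime_submodule :: "('a, 'p) ring_scheme \<Rightarrow> nat \<Rightarrow> (nat \<Rightarrow> 'a) set \<Rightarrow> bool" where
  "semiprime_submodule A n N \<longleftrightarrow> submodule N A (power_module A n) \<and>
    (\<forall>f\<in>carrier (power_module A n).
      (\<forall>i<n. \<forall>a\<in>carrier A. (f i \<otimes>\<^bsub>A\<^esub> a) \<odot>\<^bsub>power_module A n\<^esub> f \<in> N) \<longrightarrow> f \<in> N)"

definition prime_submodule ::
    "('a, 'p) ring_scheme \<Rightarrow> ('a, 'b, 'q) module_scheme \<Rightarrow> 'b set \<Rightarrow> bool" where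
  "prime_submodule A M N \<longleftrightarrow> submodule N A M \<and>
    (\<forall>a\<in>carrier A. \<forall>m\<in>carrier M.
      (\<forall>x\<in>carrier A. (a \<otimes>\<^bsub>A\<^esub> x) \<odot>\<^bsub>M\<^esub> m \<in> N) \<longrightarrow> a \<in> colon A M N \<or> m \<in> N)"

definition P_prime_submodule ::
    "('a, 'p) ring_scheme \<Rightarrow> ('a, 'b, 'q) module_scheme \<Rightarrow> 'a set \<Rightarrow> 'b set \<Rightarrow> bool" where
  "P_prime_submodule A M P N \<longleftrightarrow> prime_submodule A M N \<and> colon A M N = P"

text \<open>\<open>LEAST\<close> refers to inclusion of sets.\<close>

definition P_prime_hull ::
    "('a, 'p) ring_scheme \<Rightarrow> ('a, 'b, 'q) module_scheme \<Rightarrow> 'b set \<Rightarrow> 'a set \<Rightarrow> 'b set" where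
  "P_prime_hull A M N P =
    (if \<exists>K. P_prime_submodule A M P K \<and> N \<subseteq> K
     then LEAST K. P_prime_submodule A M P K \<and> N \<subseteq> K
     else carrier M)"

lemma P_prime_submodule_Inter:
  assumes "\<K> \<noteq> {}" and "\<And>K. K \<in> \<K> \<Longrightarrow> P_prime_submodule A M P K"
  shows "P_prime_submodule A M P (\<Inter>\<K>)"
proof -
  have sub: "submodule K A M" and col: "colon A M K = P"
    and prime: "\<And>a m. \<lbrakk>a \<in> carrier A; m \<in> carrier M;
        \<forall>x\<in>carrier A. (a \<otimes>\<^bsub>A\<^esub> x) \<odot>\<^bsub>M\<^esub> m \<in> K\<rbrakk> \<Longrightarrow> a \<in> P \<or> m \<in> K"
    if "K \<in> \<K>" for K
    using assms(2)[OF that] by (auto simp: P_prime_submodule_def prime_submodule_def)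
  have "submodule (\<Inter>\<K>) A M"
  proof (intro submodule.intro subgroup.intro submodule_axioms.intro)
    from assms(1) obtain K where "K \<in> \<K>" by blast
    then show "\<Inter>\<K> \<subseteq> carrier (add_monoid M)"
      using subgroup.subset[OF submodule.axioms(1)[OF sub]] by blast
  next
    fix x y assume "x \<in> \<Inter>\<K>" "y \<in> \<Inter>\<K>"
    then show "x \<otimes>\<^bsub>add_monoid M\<^esub> y \<in> \<Inter>\<K>"
      using subgroup.m_closed[OF submodule.axioms(1)[OF sub]] by (meson InterE InterI)
  next
    show "\<one>\<^bsub>add_monoid M\<^esub> \<in> \<Inter>\<K>"
      using subgroup.one_closed[OF submodule.axioms(1)[OF sub]] by (meson InterI)
  next
    fix x assume "x \<in> \<Inter>\<K>"
    then show "inv\<^bsub>add_monoid M\<^esub> x \<in> \<Inter>\<K>"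
      using subgroup.m_inv_closed[OF submodule.axioms(1)[OF sub]] by (meson InterE InterI)
  next
    fix a x assume "a \<in> carrier A" "x \<in> \<Inter>\<K>"
    then show "a \<odot>\<^bsub>M\<^esub> x \<in> \<Inter>\<K>"
      using submodule.smult_closed[OF sub] by (meson InterE InterI)
  qed
  moreover have c: "colon A M (\<Inter>\<K>) = P"
  proof -
    have "colon A M (\<Inter>\<K>) = (\<Inter>K\<in>\<K>. colon A M K)"
      using assms(1) by (auto simp: colon_def)
    also have "\<dots> = P" using assms(1) col by simp
    finally show ?thesis .
  qed
  moreover have "a \<in> P \<or> m \<in> \<Inter>\<K>"
    if "a \<in> carrier A" "m \<in> carrier M"
      "\<forall>x\<in>carrier A. (a \<otimes>\<^bsub>A\<^esub> x) \<odot>\<^bsub>M\<^esub> m \<in> \<Inter>\<K>" for a m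
    using prime[OF _ that(1,2)] that(3) by (meson InterE InterI)
  ultimately show ?thesis
    by (simp add: P_prime_submodule_def prime_submodule_def)
qed

lemma P_prime_hull_least:
  assumes "P_prime_submodule A M P K" "N \<subseteq> K"
  shows "P_prime_submodule A M P (P_prime_hull A M N P)"
    and "N \<subseteq> P_prime_hull A M N P" and "P_prime_hull A M N P \<subseteq> K"
proof -
  let ?\<K> = "{K. P_prime_submodule A M P K \<and> N \<subseteq> K}"
  have P: "P_prime_submodule A M P (\<Inter>?\<K>)"
    using assms by (intro P_prime_submodule_Inter) auto
  have "(LEAST K. P_prime_submodule A M P K \<and> N \<subseteq> K) = \<Inter>?\<K>"
  proof (rule Least_equality)
    show "P_prime_submodule A M P (\<Inter>?\<K>) \<and> N \<subseteq> \<Inter>?\<K>"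
      by (intro conjI P Inter_greatest) simp
    show "\<Inter>?\<K> \<subseteq> K'" if "P_prime_submodule A M P K' \<and> N \<subseteq> K'" for K'
      using that by (intro Inter_lower) simp
  qed
  then have "P_prime_hull A M N P = \<Inter>?\<K>"
    using assms unfolding P_prime_hull_def by (metis (no_types, lifting))
  moreover have "N \<subseteq> \<Inter>?\<K>" by (intro Inter_greatest) simp
  moreover have "\<Inter>?\<K> \<subseteq> K" using assms by (intro Inter_lower) simp
  ultimately show "P_prime_submodule A M P (P_prime_hull A M N P)"
    "N \<subseteq> P_prime_hull A M N P" "P_prime_hull A M N P \<subseteq> K"
    using P by simp_all
qed

end

theory Submission
  imports Defs
begin

text \<open>
  Let \<open>A = D \<otimes> R\<close>, let \<open>Z\<close> be the image of \<open>R\<close> in the center of \<open>A\<close>, and regard \<open>M = A\<^sup>n\<close> as a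
  \<open>Z\<close>-module. For a prime ideal \<open>p\<close> of \<open>Z\<close>, let \<open>K\<close> be the set of all \<open>m \<in> M\<close> with \<open>s m \<in> N + pM\<close>
  for some \<open>s \<in> Z - p\<close>. Since \<open>D\<close> is central simple, \<open>I = A (I \<inter> Z)\<close> for every ideal \<open>I\<close> of \<open>A\<close>;
  hence \<open>K\<close> is a prime \<open>A\<close>-submodule, and \<open>(K : M) = P\<close> if \<open>p = P \<inter> Z\<close> and \<open>K \<noteq> M\<close>. This reduces
  everything to commutative algebra: if \<open>f \<notin> N\<close>, then \<open>f \<notin> K\<close> for a minimal prime \<open>p\<close> over the ideal
  of all \<open>r \<in> Z\<close> with \<open>r f \<in> N\<close>, which is radical because \<open>N\<close> is semiprime; and if \<open>K = M\<close>, then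
  \<open>sM \<subseteq> N\<close> for some \<open>s \<in> Z - p\<close> by Nakayama's lemma.
\<close>

section \<open>Prime closures of submodules over a commutative ring\<close>

text \<open>Since \<open>A\<close> is not commutative, localization and minimal primes are used only
  over \<open>Z\<close>, and two bridges lead back to \<open>A\<close>. The first is
  \<open>I = A (I \<inter> Z)\<close>. An element of \<open>I\<close> is a sum of terms
  \<open>u c\<close> with \<open>u\<close> in a basis of \<open>D\<close> and
  \<open>c \<in> Z\<close>. If the coefficients \<open>c\<close> are kept and the basis is replaced
  by other vectors over \<open>D\<close>, the vectors whose sum stays in \<open>I\<close> form a
  sub-bimodule of a power of \<open>D\<close>. It contains a basis of \<open>D\<close> over its
  center, which forces it to be the whole power, and its unit vectors show that each
  \<open>c\<close> lies in \<open>I\<close>. The second bridge restates semiprimeness over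
  \<open>Z\<close>: it yields \<open>h \<in> N\<close> whenever \<open>h \<in> JM\<close> and
  \<open>J h \<subseteq> N\<close> for an ideal \<open>J\<close> of \<open>Z\<close>. The minimal
  prime argument then sees \<open>N\<close> only through this condition. The finite basis of
  \<open>D\<close> serves a second time: it makes \<open>M\<close> finitely generated over
  \<open>Z\<close>, as Nakayama's lemma requires.\<close>

context module
begin

text \<open>This is the product \<open>JM\<close>. The inductive form reduces claims about finite
  sums to rule induction.\<close>

inductive_set ideal_smult :: "'a set \<Rightarrow> 'c set" for J where
  zero: "\<zero>\<^bsub>M\<^esub> \<in> ideal_smult J"
| smult: "\<lbrakk>c \<in> J; m \<in> carrier M\<rbrakk> \<Longrightarrow> c \<odot>\<^bsub>M\<^esub> m \<in> ideal_smult J"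
| add: "\<lbrakk>x \<in> ideal_smult J; y \<in> ideal_smult J\<rbrakk> \<Longrightarrow> x \<oplus>\<^bsub>M\<^esub> y \<in> ideal_smult J"

text \<open>Scalars and signs move past \<open>c \<in> J\<close> onto the factor from
  \<open>M\<close>, so any subset \<open>J\<close> of the ring will do.\<close>

lemma submodule_ideal_smult:
  assumes "J \<subseteq> carrier R"
  shows "submodule (ideal_smult J) R M"
proof (rule submoduleI)
  show sub: "ideal_smult J \<subseteq> carrier M"
  proof
    show "x \<in> carrier M" if "x \<in> ideal_smult J" for x
      using that assms by induction auto
  qed
  have neg_zero: "\<ominus>\<^bsub>M\<^esub> \<zero>\<^bsub>M\<^esub> = \<zero>\<^bsub>M\<^esub>"
    by (metis M.a_inv_closed M.l_zero M.r_neg M.zero_closed)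
  show "\<ominus>\<^bsub>M\<^esub> x \<in> ideal_smult J" if "x \<in> ideal_smult J" for x
    using that
  proof induction
    case (smult c m)
    then have "\<ominus>\<^bsub>M\<^esub> (c \<odot>\<^bsub>M\<^esub> m) = c \<odot>\<^bsub>M\<^esub> (\<ominus>\<^bsub>M\<^esub> m)"
      using assms by (subst smult_r_minus) auto
    then show ?case
      using smult by (simp add: ideal_smult.smult)
  next
    case (add x y)
    then show ?case
      using sub by (simp add: subset_iff M.minus_add ideal_smult.add)
  next
    case zero
    show ?case
      unfolding neg_zero by (rule ideal_smult.zero)
  qed
  show "a \<odot>\<^bsub>M\<^esub> x \<in> ideal_smult J" if "a \<in> carrier R" "x \<in> ideal_smult J" for a x
    using that(2)
  proof induction
    case (smult c m)
    then have "a \<odot>\<^bsub>M\<^esub> (c \<odot>\<^bsub>M\<^esub> m) = c \<odot>\<^bsub>M\<^esub> (a \<odot>\<^bsub>M\<^esub> m)"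
      using assms that(1) by (metis R.m_comm smult_assoc1 subsetD)
    then show ?case
      using smult that(1) by (simp add: ideal_smult.smult)
  next
    case (add x y)
    then show ?case
      using sub that(1) by (simp add: subset_iff smult_r_distr ideal_smult.add)
  qed (use that(1) in \<open>simp add: ideal_smult.zero\<close>)
qed (auto intro: ideal_smult.intros)

text \<open>The preimage in \<open>M\<close> of the localization of \<open>N + pM\<close> at \<open>p\<close>.\<close>

definition prime_closure :: "'a set \<Rightarrow> 'c set \<Rightarrow> 'c set" where
  "prime_closure p N = {m \<in> carrier M.
    \<exists>s\<in>carrier R - p. \<exists>y\<in>N. \<exists>x\<in>ideal_smult p. s \<odot>\<^bsub>M\<^esub> m = y \<oplus>\<^bsub>M\<^esub> x}"

lemma prime_closureI:
  "\<lbrakk>m \<in> carrier M; s \<in> carrier R; s \<notin> p; y \<in> N; x \<in> ideal_smult p; s \<odot>\<^bsub>M\<^esub> m = y \<oplus>\<^bsub>M\<^esub> x\<rbrakk>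
    \<Longrightarrow> m \<in> prime_closure p N"
  unfolding prime_closure_def by blast

lemma prime_closureE:
  assumes "m \<in> prime_closure p N"
  obtains s y x where "m \<in> carrier M" "s \<in> carrier R" "s \<notin> p" "y \<in> N" "x \<in> ideal_smult p"
    "s \<odot>\<^bsub>M\<^esub> m = y \<oplus>\<^bsub>M\<^esub> x"
  using assms unfolding prime_closure_def by blast

context
  fixes p N
  assumes p: "primeideal p R" and N: "submodule N R M"
begin

interpretation p: primeideal p R by (rule p)

private lemmas N_sub = submoduleE(1)[OF N]
  and N_smult = submoduleE(4)[OF N] and N_add = submoduleE(5)[OF N]

private lemma pM: "submodule (ideal_smult p) R M"
  by (rule submodule_ideal_smult[OF p.a_subset])

private lemmas pM_sub = submoduleE(1)[OF pM]
  and pM_smult = submoduleE(4)[OF pM] and pM_add = submoduleE(5)[OF pM]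

private lemma one_notin_p: "\<one> \<notin> p"
  using p.I_notcarr p.one_imp_carrier by metis

private lemma zero_in_N: "\<zero>\<^bsub>M\<^esub> \<in> N"
  using subgroup.one_closed[OF submodule.axioms(1)[OF N]] by simp

private lemma mult_notin_p: "\<lbrakk>s \<in> carrier R; t \<in> carrier R; s \<notin> p; t \<notin> p\<rbrakk> \<Longrightarrow> s \<otimes> t \<notin> p"
  using p.I_prime by blast

lemma ideal_smult_subset_prime_closure: "ideal_smult p \<subseteq> prime_closure p N"
  by (intro subsetI prime_closureI[OF _ _ one_notin_p zero_in_N])
    (use pM_sub in \<open>auto simp: subset_iff\<close>)

lemma subset_prime_closure: "N \<subseteq> prime_closure p N"
proof
  fix y assume y: "y \<in> N"
  show "y \<in> prime_closure p N"
    by (rule prime_closureI[OF _ _ one_notin_p y ideal_smult.zero]) (use y N_sub in auto)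
qed

text \<open>Denominators multiply, and the complement of \<open>p\<close> is multiplicatively
  closed. Together with \<open>ideal_smult_subset_prime_closure\<close> this makes the quotient of
  \<open>M\<close> by the closure a torsion-free module over \<open>R/p\<close>, which is the source
  of all primeness statements below.\<close>

lemma prime_closure_cancel:
  assumes "m \<in> carrier M" "s \<in> carrier R" "s \<notin> p" "s \<odot>\<^bsub>M\<^esub> m \<in> prime_closure p N"
  shows "m \<in> prime_closure p N"
  using assms(4)
proof (rule prime_closureE)
  fix t y x assume *: "t \<in> carrier R" "t \<notin> p" "y \<in> N" "x \<in> ideal_smult p"
    "t \<odot>\<^bsub>M\<^esub> (s \<odot>\<^bsub>M\<^esub> m) = y \<oplus>\<^bsub>M\<^esub> x"
  show ?thesis
    by (rule prime_closureI[OF assms(1) _ _ *(3,4), where s = "t \<otimes> s"])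
      (use * assms mult_notin_p in \<open>auto simp: smult_assoc1\<close>)
qed

lemma submodule_prime_closure: "submodule (prime_closure p N) R M"
proof (rule submoduleI)
  show "prime_closure p N \<subseteq> carrier M"
    unfolding prime_closure_def by blast
  show "\<zero>\<^bsub>M\<^esub> \<in> prime_closure p N"
    using ideal_smult_subset_prime_closure ideal_smult.zero by blast
  show sm: "a \<odot>\<^bsub>M\<^esub> m \<in> prime_closure p N" if "a \<in> carrier R" "m \<in> prime_closure p N" for a m
    using that(2)
  proof (rule prime_closureE)
    fix s y x assume *: "m \<in> carrier M" "s \<in> carrier R" "s \<notin> p" "y \<in> N" "x \<in> ideal_smult p"
      "s \<odot>\<^bsub>M\<^esub> m = y \<oplus>\<^bsub>M\<^esub> x"
    have "s \<odot>\<^bsub>M\<^esub> (a \<odot>\<^bsub>M\<^esub> m) = a \<odot>\<^bsub>M\<^esub> (s \<odot>\<^bsub>M\<^esub> m)"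
      using * that(1) by (metis R.m_comm smult_assoc1)
    also have "\<dots> = a \<odot>\<^bsub>M\<^esub> y \<oplus>\<^bsub>M\<^esub> a \<odot>\<^bsub>M\<^esub> x"
      using * that(1) N_sub pM_sub by (simp add: subset_iff smult_r_distr)
    finally show ?thesis
      using * that(1) by (intro prime_closureI[of _ s]) (auto simp: N_smult pM_smult)
  qed
  show "\<ominus>\<^bsub>M\<^esub> m \<in> prime_closure p N" if "m \<in> prime_closure p N" for m
  proof -
    have "m \<in> carrier M" using that unfolding prime_closure_def by blast
    then have "\<ominus>\<^bsub>M\<^esub> m = (\<ominus> \<one>) \<odot>\<^bsub>M\<^esub> m"
      by (subst smult_l_minus) auto
    then show ?thesis using sm[OF _ that, of "\<ominus> \<one>"] by simp
  qed
  show "m \<oplus>\<^bsub>M\<^esub> m' \<in> prime_closure p N" if "m \<in> prime_closure p N" "m' \<in> prime_closure p N" for m m'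
    using that(1)
  proof (rule prime_closureE)
    fix s y x assume *: "m \<in> carrier M" "s \<in> carrier R" "s \<notin> p" "y \<in> N" "x \<in> ideal_smult p"
      "s \<odot>\<^bsub>M\<^esub> m = y \<oplus>\<^bsub>M\<^esub> x"
    from that(2) show ?thesis
    proof (rule prime_closureE)
      fix s' y' x' assume **: "m' \<in> carrier M" "s' \<in> carrier R" "s' \<notin> p" "y' \<in> N"
        "x' \<in> ideal_smult p" "s' \<odot>\<^bsub>M\<^esub> m' = y' \<oplus>\<^bsub>M\<^esub> x'"
      have car: "y \<in> carrier M" "y' \<in> carrier M" "x \<in> carrier M" "x' \<in> carrier M"
        using * ** N_sub pM_sub by auto
      \<comment> \<open>The product of both denominators is a common denominator for the
        sum.\<close>
      have "(s \<otimes> s') \<odot>\<^bsub>M\<^esub> (m \<oplus>\<^bsub>M\<^esub> m') = s' \<odot>\<^bsub>M\<^esub> (s \<odot>\<^bsub>M\<^esub> m) \<oplus>\<^bsub>M\<^esub> s \<odot>\<^bsub>M\<^esub> (s' \<odot>\<^bsub>M\<^esub> m')"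
        using *(1,2) **(1,2) by (simp add: smult_r_distr smult_assoc1[symmetric] R.m_comm)
      also have "\<dots> = (s' \<odot>\<^bsub>M\<^esub> y \<oplus>\<^bsub>M\<^esub> s \<odot>\<^bsub>M\<^esub> y') \<oplus>\<^bsub>M\<^esub> (s' \<odot>\<^bsub>M\<^esub> x \<oplus>\<^bsub>M\<^esub> s \<odot>\<^bsub>M\<^esub> x')"
        unfolding *(6) **(6) using *(2) **(2) car by (simp add: smult_r_distr M.a_ac)
      finally show ?thesis
        by (rule prime_closureI[rotated -1])
          (use * ** in \<open>auto simp: mult_notin_p N_smult pM_smult N_add pM_add\<close>)
    qed
  qed
qed

end

section \<open>Nakayama's lemma at a prime\<close>

lemma submodule_add_line:
  assumes L: "submodule L R M" and g: "g \<in> carrier M"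
  shows "submodule {c \<odot>\<^bsub>M\<^esub> g \<oplus>\<^bsub>M\<^esub> l | c l. c \<in> carrier R \<and> l \<in> L} R M" (is "submodule ?X R M")
proof (rule submoduleI)
  note L_sub = submoduleE(1)[OF L] and L_ops = submoduleE(3-5)[OF L]
  have L0: "\<zero>\<^bsub>M\<^esub> \<in> L"
    using subgroup.one_closed[OF submodule.axioms(1)[OF L]] by simp
  have X: "c \<odot>\<^bsub>M\<^esub> g \<oplus>\<^bsub>M\<^esub> l \<in> ?X" if "c \<in> carrier R" "l \<in> L" for c l
    using that by blast
  show "?X \<subseteq> carrier M"
    using g L_sub by auto
  show "\<zero>\<^bsub>M\<^esub> \<in> ?X"
    using X[OF R.zero_closed L0] g by simp
  fix x assume "x \<in> ?X"
  then obtain c l where x: "x = c \<odot>\<^bsub>M\<^esub> g \<oplus>\<^bsub>M\<^esub> l" "c \<in> carrier R" "l \<in> L" by blast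
  then have l: "l \<in> carrier M" using L_sub by blast
  have "\<ominus>\<^bsub>M\<^esub> x = (\<ominus> c) \<odot>\<^bsub>M\<^esub> g \<oplus>\<^bsub>M\<^esub> (\<ominus>\<^bsub>M\<^esub> l)"
    using x g l by (simp add: smult_l_minus M.minus_add)
  then show "\<ominus>\<^bsub>M\<^esub> x \<in> ?X" using X x L_ops by simp
  show "a \<odot>\<^bsub>M\<^esub> x \<in> ?X" if a: "a \<in> carrier R" for a
  proof -
    have "a \<odot>\<^bsub>M\<^esub> x = (a \<otimes> c) \<odot>\<^bsub>M\<^esub> g \<oplus>\<^bsub>M\<^esub> a \<odot>\<^bsub>M\<^esub> l"
      using x g l a by (simp add: smult_r_distr smult_assoc1)
    then show ?thesis using X[of "a \<otimes> c" "a \<odot>\<^bsub>M\<^esub> l"] x(2,3) a L_ops by simp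
  qed
  fix y assume "y \<in> ?X"
  then obtain d k where y: "y = d \<odot>\<^bsub>M\<^esub> g \<oplus>\<^bsub>M\<^esub> k" "d \<in> carrier R" "k \<in> L" by blast
  then have k: "k \<in> carrier M" using L_sub by blast
  have "x \<oplus>\<^bsub>M\<^esub> y = (c \<oplus> d) \<odot>\<^bsub>M\<^esub> g \<oplus>\<^bsub>M\<^esub> (l \<oplus>\<^bsub>M\<^esub> k)"
    using x y g l k by (simp add: smult_l_distr M.a_ac)
  then show "x \<oplus>\<^bsub>M\<^esub> y \<in> ?X" using X x(2,3) y(2,3) L_ops by simp
qed

text \<open>One generator \<open>g\<close> is removed at a time, which replaces the determinant of
  the usual proof. By \<open>full\<close>, some \<open>t \<notin> p\<close> has
  \<open>t g \<in> N + pM\<close>, and \<open>s\<close> sends \<open>pM\<close> into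
  \<open>p g + L\<close>. Hence \<open>s t g\<close> equals \<open>c g\<close> modulo
  \<open>L\<close> for some \<open>c \<in> p\<close>. So \<open>u = s t - c\<close> is outside
  \<open>p\<close> and sends \<open>g\<close> into \<open>L\<close>, and \<open>u s\<close> sends
  all of \<open>M\<close> into \<open>L\<close>.\<close>

lemma nakayama_step:
  assumes p: "primeideal p R" and L: "submodule L R M" and "N \<subseteq> L" and g: "g \<in> carrier M"
    and full: "prime_closure p N = carrier M"
    and s: "s \<in> carrier R" "s \<notin> p"
    and sM: "\<And>m. m \<in> carrier M \<Longrightarrow> \<exists>c\<in>carrier R. \<exists>l\<in>L. s \<odot>\<^bsub>M\<^esub> m = c \<odot>\<^bsub>M\<^esub> g \<oplus>\<^bsub>M\<^esub> l"
  shows "\<exists>s\<in>carrier R - p. \<forall>m\<in>carrier M. s \<odot>\<^bsub>M\<^esub> m \<in> L"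
proof -
  interpret p: primeideal p R by (rule p)
  note L_sub = submoduleE(1)[OF L] and L_ops = submoduleE(3-5)[OF L]
  have L0: "\<zero>\<^bsub>M\<^esub> \<in> L"
    using subgroup.one_closed[OF submodule.axioms(1)[OF L]] by simp
  have p_sub: "p \<subseteq> carrier R" by (rule p.a_subset)
  \<comment> \<open>The gain over \<open>sM\<close> is that the coefficient of \<open>g\<close> lies
    in \<open>p\<close>.\<close>
  have pM: "\<exists>c\<in>p. \<exists>l\<in>L. s \<odot>\<^bsub>M\<^esub> x = c \<odot>\<^bsub>M\<^esub> g \<oplus>\<^bsub>M\<^esub> l" if "x \<in> ideal_smult p" for x
    using that
  proof induction
    case zero
    show ?case
      by (rule bexI[of _ \<zero>], rule bexI[of _ "\<zero>\<^bsub>M\<^esub>"]) (use s g L0 in auto)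
  next
    case (smult a m)
    obtain c l where cl: "c \<in> carrier R" "l \<in> L" "s \<odot>\<^bsub>M\<^esub> m = c \<odot>\<^bsub>M\<^esub> g \<oplus>\<^bsub>M\<^esub> l"
      using sM[OF smult(2)] by blast
    have a: "a \<in> carrier R" and l: "l \<in> carrier M" using smult p_sub cl L_sub by auto
    have "s \<odot>\<^bsub>M\<^esub> (a \<odot>\<^bsub>M\<^esub> m) = a \<odot>\<^bsub>M\<^esub> (s \<odot>\<^bsub>M\<^esub> m)"
      using a s(1) smult(2) by (metis R.m_comm smult_assoc1)
    also have "\<dots> = (a \<otimes> c) \<odot>\<^bsub>M\<^esub> g \<oplus>\<^bsub>M\<^esub> a \<odot>\<^bsub>M\<^esub> l"
      unfolding cl(3) using a l cl(1) g by (simp add: smult_r_distr smult_assoc1)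
    finally show ?case
      using p.I_r_closed[OF smult(1) cl(1)] L_ops(2)[OF a cl(2)] by blast
  next
    case (add x y)
    obtain c l where cl: "c \<in> p" "l \<in> L" "s \<odot>\<^bsub>M\<^esub> x = c \<odot>\<^bsub>M\<^esub> g \<oplus>\<^bsub>M\<^esub> l" using add by blast
    obtain d k where dk: "d \<in> p" "k \<in> L" "s \<odot>\<^bsub>M\<^esub> y = d \<odot>\<^bsub>M\<^esub> g \<oplus>\<^bsub>M\<^esub> k" using add by blast
    have car: "c \<in> carrier R" "d \<in> carrier R" "l \<in> carrier M" "k \<in> carrier M"
      "x \<in> carrier M" "y \<in> carrier M"
      using cl dk p_sub L_sub add(1,2) submoduleE(1)[OF submodule_ideal_smult[OF p_sub]] by auto
    have "s \<odot>\<^bsub>M\<^esub> (x \<oplus>\<^bsub>M\<^esub> y) = (c \<oplus> d) \<odot>\<^bsub>M\<^esub> g \<oplus>\<^bsub>M\<^esub> (l \<oplus>\<^bsub>M\<^esub> k)"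
      using cl(3) dk(3) car g s(1) by (simp add: smult_r_distr smult_l_distr M.a_ac)
    then show ?case
      using p.a_closed[OF cl(1) dk(1)] L_ops(3)[OF cl(2) dk(2)] by blast
  qed
  have "g \<in> prime_closure p N" using full g by simp
  then obtain t y x where t: "t \<in> carrier R" "t \<notin> p" "y \<in> N" "x \<in> ideal_smult p"
    "t \<odot>\<^bsub>M\<^esub> g = y \<oplus>\<^bsub>M\<^esub> x"
    by (rule prime_closureE)
  obtain c l where cl: "c \<in> p" "l \<in> L" "s \<odot>\<^bsub>M\<^esub> x = c \<odot>\<^bsub>M\<^esub> g \<oplus>\<^bsub>M\<^esub> l"
    using pM[OF t(4)] by blast
  have y: "y \<in> L" using t(3) assms(3) by blast
  have car: "c \<in> carrier R" "l \<in> carrier M" "x \<in> carrier M" "y \<in> carrier M"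
    using cl p_sub L_sub y t(4) submoduleE(1)[OF submodule_ideal_smult[OF p_sub]] by auto
  \<comment> \<open>This is the unit \<open>1 - c\<close> of the local argument, with the
    denominators \<open>s\<close> and \<open>t\<close> cleared.\<close>
  define u where "u = s \<otimes> t \<ominus> c"
  have u: "u \<in> carrier R" unfolding u_def using s t car by simp
  have "u \<notin> p"
  proof
    assume "u \<in> p"
    then have "u \<oplus> c \<in> p" using cl(1) by (rule p.a_closed)
    moreover have "u \<oplus> c = s \<otimes> t" unfolding u_def using s t car by algebra
    ultimately show False using p.I_prime s t by metis
  qed
  have "(s \<otimes> t) \<odot>\<^bsub>M\<^esub> g = s \<odot>\<^bsub>M\<^esub> y \<oplus>\<^bsub>M\<^esub> (c \<odot>\<^bsub>M\<^esub> g \<oplus>\<^bsub>M\<^esub> l)"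
    using s t car g cl(3) by (simp add: smult_assoc1 smult_r_distr)
  also have "\<dots> = c \<odot>\<^bsub>M\<^esub> g \<oplus>\<^bsub>M\<^esub> (s \<odot>\<^bsub>M\<^esub> y \<oplus>\<^bsub>M\<^esub> l)"
    using s car g by (simp add: M.a_ac)
  finally have st: "(s \<otimes> t) \<odot>\<^bsub>M\<^esub> g = c \<odot>\<^bsub>M\<^esub> g \<oplus>\<^bsub>M\<^esub> (s \<odot>\<^bsub>M\<^esub> y \<oplus>\<^bsub>M\<^esub> l)" .
  have "u \<odot>\<^bsub>M\<^esub> g = (\<ominus> c) \<odot>\<^bsub>M\<^esub> g \<oplus>\<^bsub>M\<^esub> (s \<otimes> t) \<odot>\<^bsub>M\<^esub> g"
    unfolding u_def using s t car g by (simp add: smult_l_distr R.minus_eq M.a_ac)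
  also have "\<dots> = s \<odot>\<^bsub>M\<^esub> y \<oplus>\<^bsub>M\<^esub> l"
    unfolding st using s car g by (simp add: smult_l_minus M.r_neg1)
  finally have ug: "u \<odot>\<^bsub>M\<^esub> g \<in> L" using L_ops s y cl(2) by simp
  show ?thesis
  proof (rule bexI[of _ "u \<otimes> s"], rule ballI)
    show "u \<otimes> s \<in> carrier R - p" using u s \<open>u \<notin> p\<close> p.I_prime by auto
    fix m assume m: "m \<in> carrier M"
    obtain d k where dk: "d \<in> carrier R" "k \<in> L" "s \<odot>\<^bsub>M\<^esub> m = d \<odot>\<^bsub>M\<^esub> g \<oplus>\<^bsub>M\<^esub> k"
      using sM[OF m] by blast
    have k: "k \<in> carrier M" using dk L_sub by blast
    have "(u \<otimes> s) \<odot>\<^bsub>M\<^esub> m = d \<odot>\<^bsub>M\<^esub> (u \<odot>\<^bsub>M\<^esub> g) \<oplus>\<^bsub>M\<^esub> u \<odot>\<^bsub>M\<^esub> k"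
      using u s m dk k g by (simp add: smult_assoc1 smult_r_distr)
        (simp add: smult_assoc1[symmetric] R.m_comm)
    then show "(u \<otimes> s) \<odot>\<^bsub>M\<^esub> m \<in> L" using ug L_ops dk u by simp
  qed
qed

text \<open>Induction on the generators with \<open>N\<close> fixed in \<open>full\<close> and
  \<open>L\<close> growing. Passing from \<open>L\<close> to \<open>R g + L\<close> lets the
  remaining generators suffice; \<open>nakayama_step\<close> then gets rid of \<open>g\<close>. When
  no generators are left, \<open>L\<close> is all of \<open>M\<close> and \<open>s = 1\<close>
  works.\<close>

lemma nakayama:
  assumes p: "primeideal p R" and full: "prime_closure p N = carrier M"
    and "finite G" "G \<subseteq> carrier M" "submodule L R M" "N \<subseteq> L"
    and "\<And>L'. \<lbrakk>submodule L' R M; L \<union> G \<subseteq> L'\<rbrakk> \<Longrightarrow> L' = carrier M"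
  shows "\<exists>s\<in>carrier R - p. \<forall>m\<in>carrier M. s \<odot>\<^bsub>M\<^esub> m \<in> L"
  using assms(3-)
proof (induction G arbitrary: L)
  case empty
  interpret p: primeideal p R by (rule p)
  have "L = carrier M" using empty by blast
  moreover have "\<one> \<notin> p" using p.I_notcarr p.one_imp_carrier by metis
  ultimately show ?case by (intro bexI[of _ \<one>]) auto
next
  case (insert g G)
  let ?X = "{c \<odot>\<^bsub>M\<^esub> g \<oplus>\<^bsub>M\<^esub> l | c l. c \<in> carrier R \<and> l \<in> L}"
  have g: "g \<in> carrier M" using insert.prems by blast
  note L_sub = submoduleE(1)[OF insert.prems(2)]
  have L0: "\<zero>\<^bsub>M\<^esub> \<in> L"
    using subgroup.one_closed[OF submodule.axioms(1)[OF insert.prems(2)]] by simp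
  have "g = \<one> \<odot>\<^bsub>M\<^esub> g \<oplus>\<^bsub>M\<^esub> \<zero>\<^bsub>M\<^esub>" using g by simp
  then have gX: "g \<in> ?X" using L0 by blast
  have LX: "L \<subseteq> ?X"
  proof
    fix l assume l: "l \<in> L"
    then have "l = \<zero> \<odot>\<^bsub>M\<^esub> g \<oplus>\<^bsub>M\<^esub> l" using g L_sub by auto
    then show "l \<in> ?X" using l by blast
  qed
  have "\<exists>s\<in>carrier R - p. \<forall>m\<in>carrier M. s \<odot>\<^bsub>M\<^esub> m \<in> ?X"
  proof (rule insert.IH)
    show "G \<subseteq> carrier M" using insert.prems by blast
    show "submodule ?X R M" by (rule submodule_add_line[OF insert.prems(2) g])
    show "N \<subseteq> ?X" using insert.prems(3) LX by (rule subset_trans)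
    show "L' = carrier M" if "submodule L' R M" "?X \<union> G \<subseteq> L'" for L'
      using that gX LX by (intro insert.prems(4)) auto
  qed
  then obtain s where s: "s \<in> carrier R" "s \<notin> p" "\<forall>m\<in>carrier M. s \<odot>\<^bsub>M\<^esub> m \<in> ?X" by blast
  show ?case
    by (rule nakayama_step[OF p insert.prems(2,3) g full s(1,2)]) (use s(3) in blast)
qed

section \<open>Minimal primes over a radical ideal\<close>

text \<open>Zorn's lemma is applied to the multiplicative sets \<open>T\<close> disjoint from
  \<open>J\<close>, and \<open>p\<close> is the complement of a maximal one. Maximality of
  \<open>T\<close> gives the last conclusion directly. That conclusion is minimality of
  \<open>p\<close> in the form used later: \<open>J\<close> and \<open>p\<close> agree after
  localization at \<open>p\<close>.\<close>

lemma exists_minimal_prime: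
  assumes J: "ideal J R" and "J \<noteq> carrier R"
    and rad: "\<And>r. \<lbrakk>r \<in> carrier R; r \<otimes> r \<in> J\<rbrakk> \<Longrightarrow> r \<in> J"
  obtains p where "primeideal p R" "J \<subseteq> p" "\<And>q. q \<in> p \<Longrightarrow> \<exists>t\<in>carrier R - p. t \<otimes> q \<in> J"
proof -
  interpret J: ideal J R by (rule J)
  define \<T> where "\<T> = {T. T \<subseteq> carrier R \<and> \<one> \<in> T \<and> T \<inter> J = {} \<and> (\<forall>s\<in>T. \<forall>t\<in>T. s \<otimes> t \<in> T)}"
  have "\<one> \<notin> J" using assms(2) J.one_imp_carrier by metis
  then have "{\<one>} \<in> \<T>" unfolding \<T>_def by simp
  moreover have "\<Union>\<C> \<in> \<T>" if ne: "\<C> \<noteq> {}" and ch: "subset.chain \<T> \<C>" for \<C>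
  proof -
    have sub: "\<C> \<subseteq> \<T>" using ch by (simp add: subset_chain_def)
    have "s \<otimes> t \<in> \<Union>\<C>" if st: "s \<in> S" "S \<in> \<C>" "t \<in> T" "T \<in> \<C>" for s t S T
    proof -
      have "S \<subseteq> T \<or> T \<subseteq> S" using ch st by (auto simp: subset_chain_def)
      then obtain U where U: "U \<in> \<C>" "s \<in> U" "t \<in> U" using st by blast
      then have "U \<in> \<T>" using sub by blast
      then have "s \<otimes> t \<in> U" unfolding \<T>_def using U by simp
      then show ?thesis using U by blast
    qed
    moreover have "\<Union>\<C> \<subseteq> carrier R" "\<one> \<in> \<Union>\<C>" "\<Union>\<C> \<inter> J = {}"
      using ne sub unfolding \<T>_def by fast+
    ultimately show ?thesis unfolding \<T>_def by blast
  qed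
  ultimately obtain T where T: "T \<in> \<T>" and max: "\<And>U. \<lbrakk>U \<in> \<T>; T \<subseteq> U\<rbrakk> \<Longrightarrow> U = T"
    using subset_Zorn_nonempty[of \<T>] by blast
  have TR: "\<And>t. t \<in> T \<Longrightarrow> t \<in> carrier R" and T1: "\<one> \<in> T" and TJ: "T \<inter> J = {}"
    and Tm: "\<And>s t. \<lbrakk>s \<in> T; t \<in> T\<rbrakk> \<Longrightarrow> s \<otimes> t \<in> T"
    using T unfolding \<T>_def by auto
  \<comment> \<open>Radicality is given for squares only, so the exponent drops one at a time: for
    \<open>k \<ge> 1\<close> the square of \<open>t q^k\<close> is a multiple of
    \<open>t q^(k+1)\<close>.\<close>
  have pow: "t \<otimes> q \<in> J" if "t \<in> carrier R" "q \<in> carrier R" "t \<otimes> q [^] k \<in> J" for t q and k :: nat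
    using that(3)
  proof (induction k)
    case 0
    then show ?case using that J.I_r_closed by simp
  next
    case (Suc k)
    let ?r = "t \<otimes> q [^] k"
    show ?case
    proof (cases k)
      case 0
      then show ?thesis using Suc that by simp
    next
      case k: (Suc j)
      have "?r \<otimes> ?r = (t \<otimes> q [^] Suc k) \<otimes> (t \<otimes> q [^] j)"
        unfolding k using that(1,2) by (simp add: R.m_ac)
      then have "?r \<otimes> ?r \<in> J" using Suc.prems that(1,2) J.I_r_closed by simp
      with that(1,2) have "?r \<in> J"
        by (metis R.m_closed R.nat_pow_closed rad)
      then show ?thesis by (rule Suc.IH)
    qed
  qed
  \<comment> \<open>Otherwise \<open>pow\<close> keeps all products \<open>t q^k\<close> outside
    \<open>J\<close>; they form a member of \<open>\<T>\<close> containing \<open>T\<close> and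
    \<open>q\<close>, against maximality.\<close>
  have notT: "\<exists>t\<in>T. t \<otimes> q \<in> J" if q: "q \<in> carrier R" "q \<notin> T" for q
  proof (rule ccontr)
    assume no: "\<not> ?thesis"
    let ?X = "{t \<otimes> q [^] k | t (k::nat). t \<in> T}"
    have X: "t \<otimes> q [^] k \<in> ?X" if "t \<in> T" for t and k :: nat
      using that by blast
    have "?X \<in> \<T>"
      unfolding \<T>_def
    proof (rule CollectI, intro conjI ballI)
      show "?X \<subseteq> carrier R" using TR q by auto
      show "\<one> \<in> ?X" using X[OF T1, of 0] by simp
      show "?X \<inter> J = {}" using no pow TR q by blast
      fix x y assume "x \<in> ?X" "y \<in> ?X"
      then obtain s t and j k :: nat where "x = s \<otimes> q [^] j" "y = t \<otimes> q [^] k" "s \<in> T" "t \<in> T"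
        by blast
      then have "x \<otimes> y = (s \<otimes> t) \<otimes> q [^] (j + k)" "s \<otimes> t \<in> T"
        using TR q Tm by (auto simp: R.nat_pow_mult[symmetric] R.m_ac)
      then show "x \<otimes> y \<in> ?X" using X by simp
    qed
    moreover have "T \<subseteq> ?X"
    proof
      fix t assume "t \<in> T"
      then show "t \<in> ?X" using X[of t 0] TR by simp
    qed
    ultimately have "?X = T" by (rule max)
    moreover have "q \<in> ?X" using X[OF T1, of 1] q by simp
    ultimately show False using q by blast
  qed
  let ?p = "carrier R - T"
  \<comment> \<open>In this form \<open>p\<close> is visibly closed under sums, by multiplying the
    witnesses from \<open>T\<close>. Primeness is then just that \<open>T\<close> is closed under
    products.\<close>
  have p_iff: "q \<in> ?p \<longleftrightarrow> (q \<in> carrier R \<and> (\<exists>t\<in>T. t \<otimes> q \<in> J))" for q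
    using notT Tm TJ by blast
  have p_E: "\<exists>t. t \<in> T \<and> t \<otimes> q \<in> J \<and> q \<in> carrier R" if "q \<in> ?p" for q
    using that unfolding p_iff by blast
  have J0: "\<zero> \<in> J" by simp
  have idl: "ideal ?p R"
  proof (rule idealI)
    show "ring R" by (rule R.ring_axioms)
    show "subgroup ?p (add_monoid R)"
    proof (rule R.add.subgroupI)
      show "?p \<subseteq> carrier R" by blast
      have "\<one> \<otimes> \<zero> \<in> J" using J0 by simp
      then have "\<zero> \<in> ?p" unfolding p_iff using T1 R.zero_closed by blast
      then show "?p \<noteq> {}" by blast
      show "\<ominus> a \<in> ?p" if a: "a \<in> ?p" for a
      proof -
        obtain t where t: "t \<in> T" "t \<otimes> a \<in> J" "a \<in> carrier R" using p_E[OF a] by blast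
        have "\<ominus> (t \<otimes> a) \<in> J" by (rule J.a_inv_closed[OF t(2)])
        then have "t \<otimes> (\<ominus> a) \<in> J" using TR[OF t(1)] t(3) by (simp add: R.r_minus)
        with t(1,3) show ?thesis unfolding p_iff by blast
      qed
      show "a \<oplus> b \<in> ?p" if a: "a \<in> ?p" and b: "b \<in> ?p" for a b
      proof -
        obtain t where t: "t \<in> T" "t \<otimes> a \<in> J" "a \<in> carrier R" using p_E[OF a] by blast
        obtain s where s: "s \<in> T" "s \<otimes> b \<in> J" "b \<in> carrier R" using p_E[OF b] by blast
        have "(t \<otimes> s) \<otimes> (a \<oplus> b) = s \<otimes> (t \<otimes> a) \<oplus> t \<otimes> (s \<otimes> b)"
          using s t TR by (simp add: R.r_distr R.m_ac)
        moreover have "\<dots> \<in> J"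
          by (rule J.a_closed[OF J.I_l_closed[OF t(2) TR[OF s(1)]] J.I_l_closed[OF s(2) TR[OF t(1)]]])
        ultimately have "(t \<otimes> s) \<otimes> (a \<oplus> b) \<in> J" by simp
        moreover have "t \<otimes> s \<in> T" using s t Tm by simp
        moreover have "a \<oplus> b \<in> carrier R" using s t by simp
        ultimately show ?thesis unfolding p_iff by blast
      qed
    qed
    show xa: "x \<otimes> a \<in> ?p" if a: "a \<in> ?p" and x: "x \<in> carrier R" for a x
    proof -
      obtain t where t: "t \<in> T" "t \<otimes> a \<in> J" "a \<in> carrier R" using p_E[OF a] by blast
      then have "t \<otimes> (x \<otimes> a) = x \<otimes> (t \<otimes> a)" using TR x by (simp add: R.m_ac)
      then have "t \<otimes> (x \<otimes> a) \<in> J" using J.I_l_closed[OF t(2) x] by simp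
      moreover have "x \<otimes> a \<in> carrier R" using t x by simp
      ultimately show ?thesis unfolding p_iff using t by blast
    qed
    show "a \<otimes> x \<in> ?p" if a: "a \<in> ?p" and x: "x \<in> carrier R" for a x
    proof -
      have "a \<otimes> x = x \<otimes> a" using a x by (simp add: R.m_comm)
      then show ?thesis using xa[OF a x] by simp
    qed
  qed
  show thesis
  proof
    show "primeideal ?p R"
      by (rule primeidealI[OF idl R.is_cring]) (use T1 Tm in auto)
    show "J \<subseteq> ?p" using TJ J.a_subset by blast
    show "\<exists>t\<in>carrier R - ?p. t \<otimes> q \<in> J" if "q \<in> ?p" for q
      using p_E[OF that] TR by blast
  qed
qed

text \<open>For \<open>M = R\<^sup>n\<close> the hypothesis \<open>semi\<close> is equivalent to semiprimeness. The prime \<open>p\<close> is a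
  minimal prime over \<open>J = (N : f)\<close>. If \<open>s f = y + x\<close> with \<open>y \<in> N\<close> and \<open>x \<in> pM\<close>, then \<open>h = t x\<close> lies
  in \<open>JM\<close> for some \<open>t \<notin> p\<close>, and \<open>Jh \<subseteq> N\<close> since \<open>h \<in> t s f + N\<close>; so \<open>h \<in> N\<close> and \<open>t s \<in> J\<close>.\<close>

lemma exists_prime_closure_avoiding:
  assumes N: "submodule N R M"
    and semi: "\<And>J h. \<lbrakk>ideal J R; h \<in> ideal_smult J; \<And>c. c \<in> J \<Longrightarrow> c \<odot>\<^bsub>M\<^esub> h \<in> N\<rbrakk> \<Longrightarrow> h \<in> N"
    and f: "f \<in> carrier M" "f \<notin> N"
  shows "\<exists>p. primeideal p R \<and> f \<notin> prime_closure p N"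
proof -
  note N_sub = submoduleE(1)[OF N] and N_ops = submoduleE(3-5)[OF N]
  have N0: "\<zero>\<^bsub>M\<^esub> \<in> N"
    using subgroup.one_closed[OF submodule.axioms(1)[OF N]] by simp
  define J where "J = {r \<in> carrier R. r \<odot>\<^bsub>M\<^esub> f \<in> N}"
  have J: "ideal J R"
  proof (rule idealI)
    show "ring R" by (rule R.ring_axioms)
    show "subgroup J (add_monoid R)"
    proof (rule R.add.subgroupI)
      show "J \<subseteq> carrier R" unfolding J_def by blast
      have "\<zero> \<in> J" unfolding J_def using f N0 by simp
      then show "J \<noteq> {}" by blast
      show "\<ominus> a \<in> J" if "a \<in> J" for a
        using that f N_ops unfolding J_def by (simp add: smult_l_minus)
      show "a \<oplus> b \<in> J" if "a \<in> J" "b \<in> J" for a b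
        using that f N_ops unfolding J_def by (simp add: smult_l_distr)
    qed
    show xa: "x \<otimes> a \<in> J" if "a \<in> J" "x \<in> carrier R" for a x
      using that f N_ops unfolding J_def by (simp add: smult_assoc1)
    show "a \<otimes> x \<in> J" if "a \<in> J" "x \<in> carrier R" for a x
    proof -
      have "a \<otimes> x = x \<otimes> a" using that J_def by (simp add: R.m_comm)
      then show ?thesis using xa[OF that] by simp
    qed
  qed
  interpret J: ideal J R by (rule J)
  have JR: "J \<subseteq> carrier R" unfolding J_def by blast
  have "\<one> \<notin> J" unfolding J_def using f by simp
  then have "J \<noteq> carrier R" by auto
  \<comment> \<open>\<open>J\<close> is radical: \<open>semi\<close> is applied to the principal
    ideal of \<open>r\<close> and to \<open>h = r f\<close>, since every multiple of
    \<open>r\<close> sends \<open>h\<close> to a multiple of \<open>(r r) f \<in> N\<close>.\<close>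
  moreover have "r \<in> J" if r: "r \<in> carrier R" "r \<otimes> r \<in> J" for r
  proof -
    have "r \<odot>\<^bsub>M\<^esub> f \<in> N"
    proof (rule semi)
      show "ideal (PIdl r) R" by (rule R.cgenideal_ideal[OF r(1)])
      show "r \<odot>\<^bsub>M\<^esub> f \<in> ideal_smult (PIdl r)"
        by (rule ideal_smult.smult[OF R.cgenideal_self[OF r(1)] f(1)])
      fix c assume "c \<in> PIdl r"
      then obtain x where x: "x \<in> carrier R" "c = x \<otimes> r" unfolding cgenideal_def by blast
      have "c \<odot>\<^bsub>M\<^esub> (r \<odot>\<^bsub>M\<^esub> f) = x \<odot>\<^bsub>M\<^esub> ((r \<otimes> r) \<odot>\<^bsub>M\<^esub> f)"
        unfolding x(2) using x(1) r f by (simp add: smult_assoc1)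
      then show "c \<odot>\<^bsub>M\<^esub> (r \<odot>\<^bsub>M\<^esub> f) \<in> N"
        using x r N_ops unfolding J_def by simp
    qed
    then show ?thesis unfolding J_def using r by blast
  qed
  ultimately obtain p where p: "primeideal p R" and Jp: "J \<subseteq> p"
    and tq: "\<And>q. q \<in> p \<Longrightarrow> \<exists>t\<in>carrier R - p. t \<otimes> q \<in> J"
    using exists_minimal_prime[OF J] by metis
  interpret p: primeideal p R by (rule p)
  have p_sub: "p \<subseteq> carrier R" by (rule p.a_subset)
  have p1: "\<one> \<notin> p" using p.I_notcarr p.one_imp_carrier by metis
  note pM_sub = submoduleE(1)[OF submodule_ideal_smult[OF p_sub]]
    and JM_ops = submoduleE(3-5)[OF submodule_ideal_smult[OF JR]]
  \<comment> \<open>The local equality of \<open>p\<close> and \<open>J\<close> carries over to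
    \<open>pM\<close> and \<open>JM\<close>; a sum uses the product of the multipliers of its
    terms.\<close>
  have clear: "\<exists>t\<in>carrier R - p. t \<odot>\<^bsub>M\<^esub> x \<in> ideal_smult J" if "x \<in> ideal_smult p" for x
    using that
  proof induction
    case zero
    then show ?case using p1 by (intro bexI[of _ \<one>]) (auto intro: ideal_smult.zero)
  next
    case (smult c m)
    obtain t where t: "t \<in> carrier R - p" "t \<otimes> c \<in> J" using tq smult by blast
    then have "t \<odot>\<^bsub>M\<^esub> (c \<odot>\<^bsub>M\<^esub> m) = (t \<otimes> c) \<odot>\<^bsub>M\<^esub> m"
      using smult p_sub by (simp add: subset_iff smult_assoc1)
    then show ?case using t smult ideal_smult.smult by metis
  next
    case (add x y)
    obtain t where t: "t \<in> carrier R" "t \<notin> p" "t \<odot>\<^bsub>M\<^esub> x \<in> ideal_smult J" using add by blast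
    obtain s where s: "s \<in> carrier R" "s \<notin> p" "s \<odot>\<^bsub>M\<^esub> y \<in> ideal_smult J" using add by blast
    have "x \<in> carrier M" "y \<in> carrier M" using add pM_sub by auto
    then have "(s \<otimes> t) \<odot>\<^bsub>M\<^esub> (x \<oplus>\<^bsub>M\<^esub> y) = s \<odot>\<^bsub>M\<^esub> (t \<odot>\<^bsub>M\<^esub> x) \<oplus>\<^bsub>M\<^esub> t \<odot>\<^bsub>M\<^esub> (s \<odot>\<^bsub>M\<^esub> y)"
      using s t by (simp add: smult_r_distr smult_assoc1[symmetric] R.m_comm)
    moreover have "\<dots> \<in> ideal_smult J" using s t JM_ops by simp
    moreover have "s \<otimes> t \<in> carrier R - p" using s t p.I_prime by auto
    ultimately show ?case by metis
  qed
  have "f \<notin> prime_closure p N"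
  proof
    assume "f \<in> prime_closure p N"
    then obtain s y x where s: "s \<in> carrier R" "s \<notin> p" "y \<in> N" "x \<in> ideal_smult p"
      "s \<odot>\<^bsub>M\<^esub> f = y \<oplus>\<^bsub>M\<^esub> x"
      by (rule prime_closureE)
    obtain t where t: "t \<in> carrier R" "t \<notin> p" "t \<odot>\<^bsub>M\<^esub> x \<in> ideal_smult J"
      using clear[OF s(4)] by blast
    have car: "x \<in> carrier M" "y \<in> carrier M" using s N_sub pM_sub by auto
    have x: "x = \<ominus>\<^bsub>M\<^esub> y \<oplus>\<^bsub>M\<^esub> s \<odot>\<^bsub>M\<^esub> f" unfolding s(5) using car by (simp add: M.r_neg1)
    have "t \<odot>\<^bsub>M\<^esub> x \<in> N"
    proof (rule semi[OF J t(3)])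
      fix c assume c: "c \<in> J"
      then have cR: "c \<in> carrier R" and cf: "c \<odot>\<^bsub>M\<^esub> f \<in> N" unfolding J_def by auto
      have "c \<odot>\<^bsub>M\<^esub> (t \<odot>\<^bsub>M\<^esub> x) = (c \<otimes> t) \<odot>\<^bsub>M\<^esub> (\<ominus>\<^bsub>M\<^esub> y) \<oplus>\<^bsub>M\<^esub> (t \<otimes> s) \<odot>\<^bsub>M\<^esub> (c \<odot>\<^bsub>M\<^esub> f)"
        unfolding x using cR car s(1,2) t f
        by (simp add: smult_r_distr smult_assoc1[symmetric] R.m_ac)
      then show "c \<odot>\<^bsub>M\<^esub> (t \<odot>\<^bsub>M\<^esub> x) \<in> N" using N_ops cf cR s t by simp
    qed
    moreover have "(t \<otimes> s) \<odot>\<^bsub>M\<^esub> f = t \<odot>\<^bsub>M\<^esub> y \<oplus>\<^bsub>M\<^esub> t \<odot>\<^bsub>M\<^esub> x"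
      using s t f car by (simp add: smult_assoc1 smult_r_distr)
    ultimately have "t \<otimes> s \<in> J" unfolding J_def using s t N_ops by simp
    then show False using Jp s t p.I_prime by blast
  qed
  with p show ?thesis by blast
qed

end

section \<open>Ideals of algebras over a central division algebra\<close>

context ring
begin

text \<open>Sub-bimodules of \<open>R^k\<close>. Vectors are lists to fit
  \<open>independent\<close>, \<open>Span\<close> and \<open>combine\<close>; negatives come from
  multiplication by \<open>\<ominus> \<one>\<close>.\<close>

definition sub_bimodule :: "nat \<Rightarrow> 'a list set \<Rightarrow> bool" where
  "sub_bimodule k W \<longleftrightarrow>
    W \<subseteq> {ws. set ws \<subseteq> carrier R \<and> length ws = k} \<and>
    (\<forall>v\<in>W. \<forall>w\<in>W. map2 (\<oplus>) v w \<in> W) \<and>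
    (\<forall>x\<in>carrier R. \<forall>w\<in>W. map ((\<otimes>) x) w \<in> W \<and> map (\<lambda>y. y \<otimes> x) w \<in> W)"

lemma map2_add_zeros_left: "set ws \<subseteq> carrier R \<Longrightarrow> map2 (\<oplus>) (replicate (length ws) \<zero>) ws = ws"
  by (induction ws) auto

lemma map2_add_uminus:
  "set ws \<subseteq> carrier R \<Longrightarrow> map2 (\<oplus>) ws (map ((\<otimes>) (\<ominus> \<one>)) ws) = replicate (length ws) \<zero>"
  by (induction ws) (auto simp: l_minus r_neg)

text \<open>The density argument. Projecting \<open>W\<close> along the first coordinate gives everything by
  induction; if the projection is injective, its inverse is a bimodule homomorphism, so it maps the
  standard basis into the center and \<open>u\<close> is a linear combination of \<open>Us\<close>.\<close>

lemma sub_bimodule_full: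
  assumes K: "subfield K R" "ring_center R = K"
    and div: "carrier R - {\<zero>} \<subseteq> Units R"
    and "independent K Us" "sub_bimodule (length Us) W" "Us \<in> W"
    and "set ws \<subseteq> carrier R" "length ws = length Us"
  shows "ws \<in> W"
  using assms(4-)
proof (induction Us arbitrary: W ws rule: list.induct)
  case Nil
  then show ?case by simp
next
  case (Cons u Us)
  define k where "k = length Us"
  define Z where "Z m = replicate m \<zero>" for m
  note W = Cons.prems(2)[unfolded sub_bimodule_def]
  have W_sub: "set ws \<subseteq> carrier R" "length ws = Suc k" if "ws \<in> W" for ws
    using subsetD[OF conjunct1[OF W] that] unfolding k_def by simp_all
  have W_add: "(v \<oplus> w) # map2 (\<oplus>) vs ws \<in> W" if "v # vs \<in> W" "w # ws \<in> W" for v vs w ws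
    using bspec[OF bspec[OF conjunct1[OF conjunct2[OF W]] that(1)] that(2)] by simp
  have W_left: "(x \<otimes> w) # map ((\<otimes>) x) ws \<in> W"
    and W_right: "(w \<otimes> x) # map (\<lambda>y. y \<otimes> x) ws \<in> W"
    if "x \<in> carrier R" "w # ws \<in> W" for x w ws
    using bspec[OF bspec[OF conjunct2[OF conjunct2[OF W]] that(1)] that(2)] by simp_all
  have ind: "u \<notin> Span K Us" "independent K Us" "u \<in> carrier R"
    using independent_backwards[OF Cons.prems(1)] by auto
  have Us: "set Us \<subseteq> carrier R" using independent_in_carrier[OF ind(2)] .
  let ?W' = "{ws. \<exists>w. w # ws \<in> W}"
  have "sub_bimodule (length Us) ?W'"
    unfolding sub_bimodule_def
  proof (intro conjI ballI)
    show "?W' \<subseteq> {ws. set ws \<subseteq> carrier R \<and> length ws = length Us}"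
      using W_sub unfolding k_def by fastforce
    show "map2 (\<oplus>) v w \<in> ?W'" if "v \<in> ?W'" "w \<in> ?W'" for v w
      using that W_add by blast
    show "map ((\<otimes>) x) w \<in> ?W'" if "x \<in> carrier R" "w \<in> ?W'" for x w
      using that W_left by blast
    show "map (\<lambda>y. y \<otimes> x) w \<in> ?W'" if "x \<in> carrier R" "w \<in> ?W'" for x w
      using that W_right by blast
  qed
  then have full: "\<exists>w. w # ws \<in> W" if "set ws \<subseteq> carrier R" "length ws = k" for ws
    using Cons.IH[OF ind(2), of ?W' ws] Cons.prems(3) that unfolding k_def by blast
  have "\<exists>\<mu>. \<mu> # Z k \<in> W \<and> \<mu> \<noteq> \<zero>"
  proof (rule ccontr)
    assume "\<not> ?thesis"
    then have zero: "\<mu> = \<zero>" if "\<mu> # Z k \<in> W" for \<mu> using that by blast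
    have unique: "v = w" if v: "v # ws \<in> W" and w: "w # ws \<in> W" for v w ws
    proof -
      have car: "v \<in> carrier R" "w \<in> carrier R" "set ws \<subseteq> carrier R" "length ws = k"
        using W_sub[OF v] W_sub[OF w] by auto
      have "(v \<oplus> \<ominus> \<one> \<otimes> w) # map2 (\<oplus>) ws (map ((\<otimes>) (\<ominus> \<one>)) ws) \<in> W"
        by (intro W_add W_left v w) simp
      then have "v \<oplus> \<ominus> \<one> \<otimes> w = \<zero>"
        using zero car by (simp add: map2_add_uminus Z_def)
      then show ?thesis using car by (simp add: l_minus minus_equality flip: minus_eq)
    qed
    \<comment> \<open>This is strengthened for induction: \<open>vs\<close> is what follows
      \<open>m\<close> leading zeros. The instance \<open>vs = Us\<close>, \<open>m = 0\<close>,
      \<open>w = u\<close> contradicts independence.\<close>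
    have "w \<in> Span K vs"
      if "set vs \<subseteq> carrier R" "m + length vs = k" "w # (Z m @ vs) \<in> W" for vs m w
      using that
    proof (induction vs arbitrary: m w)
      case Nil
      then show ?case using zero by simp
    next
      case (Cons v vs)
      \<comment> \<open>The multiples of the standard basis vector at position
        \<open>m\<close>.\<close>
      define e where "e y = Z m @ y # Z (length vs)" for y
      have v: "v \<in> carrier R" and vs: "set vs \<subseteq> carrier R" using Cons.prems by auto
      have e: "set (e y) \<subseteq> carrier R" "length (e y) = k" if "y \<in> carrier R" for y
        using that Cons.prems(2) unfolding e_def Z_def by auto
      have e_left: "map ((\<otimes>) x) (e y) = e (x \<otimes> y)" and e_right: "map (\<lambda>z. z \<otimes> x) (e y) = e (y \<otimes> x)"
        if "x \<in> carrier R" for x y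
        using that unfolding e_def Z_def by (simp_all add: map_replicate)
      obtain l where l: "l # e \<one> \<in> W" using full e[of \<one>] by blast
      have lR: "l \<in> carrier R" using W_sub[OF l] by auto
      \<comment> \<open>Multiplying \<open>l # e \<one>\<close> by \<open>x\<close> from the left
        and from the right gives two vectors of \<open>W\<close> with the same tail
        \<open>e x\<close>; by \<open>unique\<close> their heads agree.\<close>
      have "l \<otimes> x = x \<otimes> l" if x: "x \<in> carrier R" for x
        using W_left[OF x l] W_right[OF x l] unique x by (simp add: e_left e_right)
      then have lK: "l \<in> K" using lR K(2) unfolding ring_center_def by blast
      have "set (Z (Suc m) @ vs) \<subseteq> carrier R" "length (Z (Suc m) @ vs) = k"
        using Cons.prems unfolding Z_def by auto
      then obtain w' where w': "w' # (Z (Suc m) @ vs) \<in> W" using full by blast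
      have w'R: "w' \<in> carrier R" using W_sub[OF w'] by auto
      have "w' \<in> Span K vs" by (rule Cons.IH[OF vs _ w']) (use Cons.prems in simp)
      moreover have "w = l \<otimes> v \<oplus> w'"
      proof (rule unique[OF Cons.prems(3)])
        have *: "(v \<otimes> l) # e v \<in> W" using W_left[OF v l] v by (simp add: e_left)
        have "map2 (\<oplus>) (e v) (Z (Suc m) @ vs) = Z m @ v # vs"
          unfolding e_def Z_def using v vs
          by (simp add: replicate_append_same[symmetric] map2_add_zeros_left)
        then have "(v \<otimes> l \<oplus> w') # (Z m @ v # vs) \<in> W" using W_add[OF * w'] by simp
        moreover have "v \<otimes> l = l \<otimes> v" using lK v K(2) unfolding ring_center_def by auto
        ultimately show "(l \<otimes> v \<oplus> w') # (Z m @ v # vs) \<in> W" by simp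
      qed
      ultimately show ?case using lK by (auto simp: line_extension_mem_iff)
    qed
    from this[of Us 0 u] ind Us Cons.prems(3) show False unfolding k_def Z_def by simp
  qed
  then obtain \<mu> where \<mu>: "\<mu> # Z k \<in> W" "\<mu> \<noteq> \<zero>" by blast
  then have "\<mu> \<in> Units R" using W_sub[OF \<mu>(1)] div by auto
  obtain v vs where ws: "ws = v # vs" "v \<in> carrier R" "set vs \<subseteq> carrier R" "length vs = k"
    using Cons.prems(4,5) unfolding k_def by (cases ws) auto
  obtain w where w: "w # vs \<in> W" using full ws by blast
  have wR: "w \<in> carrier R" using W_sub[OF w] by auto
  \<comment> \<open>The multiple of \<open>\<mu> # Z k\<close> that corrects the head of
    \<open>w # vs\<close> from \<open>w\<close> to \<open>v\<close>.\<close>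
  let ?x = "(v \<ominus> w) \<otimes> inv \<mu>"
  have "?x \<otimes> \<mu> = v \<ominus> w"
    using \<open>\<mu> \<in> Units R\<close> ws(2) wR by (simp add: m_assoc Units_closed)
  moreover have "map ((\<otimes>) ?x) (Z k) = Z k"
    unfolding Z_def using \<open>\<mu> \<in> Units R\<close> ws(2) wR by (simp add: map_replicate)
  ultimately have "(v \<ominus> w) # Z k \<in> W"
    using W_left[OF _ \<mu>(1), of ?x] \<open>\<mu> \<in> Units R\<close> ws(2) wR by simp
  from W_add[OF this w] have "(v \<ominus> w \<oplus> w) # vs \<in> W"
    unfolding Z_def using map2_add_zeros_left[OF ws(3)] ws(4) by simp
  moreover have "v \<ominus> w \<oplus> w = v" using ws(2) wR by algebra
  ultimately show ?case using ws(1) by simp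
qed

section \<open>Linear combinations with central coefficients\<close>

lemma combine_central_right:
  assumes "set cs \<subseteq> ring_center R" "x \<in> carrier R" "set ys \<subseteq> carrier R"
  shows "combine ys cs \<otimes> x = combine (map (\<lambda>y. y \<otimes> x) ys) cs"
  using assms
proof (induction ys cs rule: combine.induct)
  case (1 y ys c cs)
  have c: "c \<in> carrier R" "c \<otimes> x = x \<otimes> c"
    using 1 unfolding ring_center_def by auto
  have cs: "set cs \<subseteq> carrier R" using 1 unfolding ring_center_def by auto
  have "combine ys cs \<in> carrier R" using 1 cs by auto
  then have "(y \<otimes> c \<oplus> combine ys cs) \<otimes> x = y \<otimes> (c \<otimes> x) \<oplus> combine ys cs \<otimes> x"
    using 1 c(1) by (simp add: l_distr m_assoc)
  also have "\<dots> = (y \<otimes> x) \<otimes> c \<oplus> combine (map (\<lambda>y. y \<otimes> x) ys) cs"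
    using 1 c by (simp add: m_assoc)
  finally show ?case by simp
qed auto

lemma combine_mem_subgroup:
  assumes "subgroup H (add_monoid R)"
    and "\<And>x y. \<lbrakk>x \<in> set xs; y \<in> set ys\<rbrakk> \<Longrightarrow> x \<otimes> y \<in> H"
  shows "combine xs ys \<in> H"
  using assms(2)
proof (induction xs ys rule: combine.induct)
  case (1 x xs y ys)
  then show ?case using subgroup.m_closed[OF assms(1), of "x \<otimes> y" "combine xs ys"] by simp
qed (use subgroup.one_closed[OF assms(1)] in auto)

text \<open>Unit vectors pick out the entries of \<open>cs\<close>. Admitting all vectors of zeros
  and ones makes the hypothesis stable under prepending a zero, as the induction needs.\<close>

lemma combine_mem_imp_mem:
  assumes "set cs \<subseteq> carrier R"
    and "\<And>xs. \<lbrakk>set xs \<subseteq> {\<zero>, \<one>}; length xs = length cs\<rbrakk> \<Longrightarrow> combine xs cs \<in> I"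
  shows "set cs \<subseteq> I"
  using assms
proof (induction cs)
  case (Cons c cs)
  have "combine (\<one> # replicate (length cs) \<zero>) (c # cs) \<in> I"
    by (rule Cons.prems(2)) auto
  then have "c \<in> I" using Cons.prems(1) by (simp add: combine_replicate)
  moreover have "set cs \<subseteq> I"
  proof (rule Cons.IH)
    show "combine xs cs \<in> I" if "set xs \<subseteq> {\<zero>, \<one>}" "length xs = length cs" for xs
    proof -
      have "set xs \<subseteq> carrier R" using that by auto
      then have "combine xs cs \<in> carrier R" using Cons.prems(1) by auto
      then show ?thesis
        using Cons.prems(2)[of "\<zero> # xs"] Cons.prems(1) that by simp
    qed
  qed (use Cons.prems in auto)
  ultimately show ?case by simp
qed auto

lemma combine_central_commute:
  assumes "set cs \<subseteq> ring_center R" "set xs \<subseteq> carrier R"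
  shows "combine cs xs = combine xs cs"
  using assms by (induction cs xs rule: combine.induct) (auto simp: ring_center_def)

lemma exists_unit_combine:
  assumes "x \<in> set xs" "set xs \<subseteq> carrier R"
  shows "\<exists>cs. set cs \<subseteq> {\<zero>, \<one>} \<and> length cs = length xs \<and> combine cs xs = x"
  using assms
proof (induction xs)
  case (Cons y ys)
  show ?case
  proof (cases "x = y")
    case True
    then show ?thesis
      using Cons.prems
      by (intro exI[of _ "\<one> # replicate (length ys) \<zero>"]) (auto simp: combine_replicate)
  next
    case False
    then obtain cs where "set cs \<subseteq> {\<zero>, \<one>}" "length cs = length ys" "combine cs ys = x"
      using Cons by auto
    then show ?thesis
      using Cons.prems by (intro exI[of _ "\<zero> # cs"]) auto
  qed
qed simp

end

text \<open>For fixed \<open>cs\<close>, the vectors whose combination with \<open>cs\<close> lies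
  in \<open>I\<close> form a sub-bimodule: a right factor can be moved past the central
  \<open>cs\<close>. It contains \<open>Us\<close>, so \<open>sub_bimodule_full\<close> gives it
  every vector, in particular the vectors of zeros and ones demanded by
  \<open>combine_mem_imp_mem\<close>.\<close>

lemma (in ring_hom_ring) coordinates_in_ideal:
  assumes K: "subfield K R" "ring_center R = K" "carrier R - {\<zero>\<^bsub>R\<^esub>} \<subseteq> Units R"
    and Us: "R.independent K Us" and I: "ideal I S"
    and cs: "set cs \<subseteq> ring_center S" "length cs = length Us" "S.combine (map h Us) cs \<in> I"
  shows "set cs \<subseteq> I"
proof (rule S.combine_mem_imp_mem)
  interpret I: ideal I S by (rule I)
  show csS: "set cs \<subseteq> carrier S" using cs unfolding ring_center_def by auto
  let ?W = "{ws. set ws \<subseteq> carrier R \<and> length ws = length Us \<and> S.combine (map h ws) cs \<in> I}"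
  have bim: "R.sub_bimodule (length Us) ?W"
    unfolding R.sub_bimodule_def
  proof (intro conjI ballI)
    show "map2 (\<oplus>\<^bsub>R\<^esub>) v w \<in> ?W" if "v \<in> ?W" "w \<in> ?W" for v w
    proof -
      have car: "set v \<subseteq> carrier R" "set w \<subseteq> carrier R" using that by auto
      then have h: "set (map h v) \<subseteq> carrier S" "set (map h w) \<subseteq> carrier S" by auto
      have "map2 (\<oplus>\<^bsub>S\<^esub>) (map h v) (map h w) = map h (map2 (\<oplus>\<^bsub>R\<^esub>) v w)"
        using car by (induction v w rule: list_induct2') auto
      then have "S.combine (map h (map2 (\<oplus>\<^bsub>R\<^esub>) v w)) cs
          = S.combine (map h v) cs \<oplus>\<^bsub>S\<^esub> S.combine (map h w) cs"
        using S.combine_add[of "map h v" cs "map h w", OF _ _ h csS] that cs(2) by simp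
      moreover have "set (map2 (\<oplus>\<^bsub>R\<^esub>) v w) \<subseteq> carrier R"
        using car by (induction v w rule: list_induct2') auto
      ultimately show ?thesis using that I.a_closed by simp
    qed
    fix x w assume x: "x \<in> carrier R" and w: "w \<in> ?W"
    then have hw: "set (map h w) \<subseteq> carrier S" by auto
    have "map h (map ((\<otimes>\<^bsub>R\<^esub>) x) w) = map ((\<otimes>\<^bsub>S\<^esub>) (h x)) (map h w)"
      using x w by auto
    then have "S.combine (map h (map ((\<otimes>\<^bsub>R\<^esub>) x) w)) cs = h x \<otimes>\<^bsub>S\<^esub> S.combine (map h w) cs"
      using S.combine_r_distr[OF hw csS, of "h x"] x by (simp only: hom_closed)
    then show "map ((\<otimes>\<^bsub>R\<^esub>) x) w \<in> ?W" using x w I.I_l_closed by auto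
    have "map h (map (\<lambda>y. y \<otimes>\<^bsub>R\<^esub> x) w) = map (\<lambda>y. y \<otimes>\<^bsub>S\<^esub> h x) (map h w)"
      using x w by auto
    then have "S.combine (map h (map (\<lambda>y. y \<otimes>\<^bsub>R\<^esub> x) w)) cs = S.combine (map h w) cs \<otimes>\<^bsub>S\<^esub> h x"
      using S.combine_central_right[OF cs(1) _ hw, of "h x"] x by (simp only: hom_closed)
    then show "map (\<lambda>y. y \<otimes>\<^bsub>R\<^esub> x) w \<in> ?W" using x w I.I_r_closed by auto
  qed auto
  have UsW: "Us \<in> ?W" using cs R.independent_in_carrier[OF Us] by auto
  show "S.combine xs cs \<in> I" if xs: "set xs \<subseteq> {\<zero>\<^bsub>S\<^esub>, \<one>\<^bsub>S\<^esub>}" "length xs = length cs" for xs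
  proof -
    \<comment> \<open>A lift of \<open>xs\<close> along \<open>h\<close>. If \<open>S\<close> is the
      zero ring, the two possible entries coincide and are lifted to zero.\<close>
    define ws where "ws = map (\<lambda>x. if x = \<zero>\<^bsub>S\<^esub> then \<zero>\<^bsub>R\<^esub> else \<one>\<^bsub>R\<^esub>) xs"
    have "map h ws = xs"
      unfolding ws_def using xs(1) by (induction xs) auto
    moreover have "ws \<in> ?W"
      by (rule R.sub_bimodule_full[OF K Us bim UsW]) (use xs cs in \<open>auto simp: ws_def\<close>)
    ultimately show ?thesis by auto
  qed
qed

section \<open>Left modules over noncommutative rings\<close>

locale left_module = R?: ring R + M?: abelian_group M
  for R :: "('a, 'b) ring_scheme" (structure) and M :: "('a, 'c, 'd) module_scheme" (structure) +
  assumes smult_closed [simp, intro]: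
      "\<lbrakk>a \<in> carrier R; x \<in> carrier M\<rbrakk> \<Longrightarrow> a \<odot>\<^bsub>M\<^esub> x \<in> carrier M"
    and smult_l_distr:
      "\<lbrakk>a \<in> carrier R; b \<in> carrier R; x \<in> carrier M\<rbrakk> \<Longrightarrow>
        (a \<oplus> b) \<odot>\<^bsub>M\<^esub> x = a \<odot>\<^bsub>M\<^esub> x \<oplus>\<^bsub>M\<^esub> b \<odot>\<^bsub>M\<^esub> x"
    and smult_r_distr:
      "\<lbrakk>a \<in> carrier R; x \<in> carrier M; y \<in> carrier M\<rbrakk> \<Longrightarrow>
        a \<odot>\<^bsub>M\<^esub> (x \<oplus>\<^bsub>M\<^esub> y) = a \<odot>\<^bsub>M\<^esub> x \<oplus>\<^bsub>M\<^esub> a \<odot>\<^bsub>M\<^esub> y"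
    and smult_assoc:
      "\<lbrakk>a \<in> carrier R; b \<in> carrier R; x \<in> carrier M\<rbrakk> \<Longrightarrow>
        (a \<otimes> b) \<odot>\<^bsub>M\<^esub> x = a \<odot>\<^bsub>M\<^esub> (b \<odot>\<^bsub>M\<^esub> x)"
    and smult_one [simp]: "x \<in> carrier M \<Longrightarrow> \<one> \<odot>\<^bsub>M\<^esub> x = x"
begin

lemma smult_l_null [simp]:
  assumes "x \<in> carrier M"
  shows "\<zero> \<odot>\<^bsub>M\<^esub> x = \<zero>\<^bsub>M\<^esub>"
proof -
  have "\<zero> \<odot>\<^bsub>M\<^esub> x \<oplus>\<^bsub>M\<^esub> \<zero> \<odot>\<^bsub>M\<^esub> x = \<zero> \<odot>\<^bsub>M\<^esub> x"
    using smult_l_distr[of \<zero> \<zero> x] assms by simp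
  then show ?thesis
    using assms by (metis M.add.r_cancel_one' R.zero_closed smult_closed)
qed

lemma smult_r_null [simp]: "a \<in> carrier R \<Longrightarrow> a \<odot>\<^bsub>M\<^esub> \<zero>\<^bsub>M\<^esub> = \<zero>\<^bsub>M\<^esub>"
  using smult_assoc[of a \<zero> "\<zero>\<^bsub>M\<^esub>"] by simp

lemma smult_l_minus:
  assumes "a \<in> carrier R" "x \<in> carrier M"
  shows "(\<ominus> a) \<odot>\<^bsub>M\<^esub> x = \<ominus>\<^bsub>M\<^esub> (a \<odot>\<^bsub>M\<^esub> x)"
proof -
  have "(\<ominus> a) \<odot>\<^bsub>M\<^esub> x \<oplus>\<^bsub>M\<^esub> a \<odot>\<^bsub>M\<^esub> x = \<zero>\<^bsub>M\<^esub>"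
    using assms by (simp add: R.l_neg flip: smult_l_distr)
  then show ?thesis using assms by (simp add: M.minus_equality)
qed

lemma submoduleD:
  assumes "submodule N R M"
  shows "N \<subseteq> carrier M" "\<zero>\<^bsub>M\<^esub> \<in> N"
    "\<And>x. x \<in> N \<Longrightarrow> \<ominus>\<^bsub>M\<^esub> x \<in> N"
    "\<And>x y. \<lbrakk>x \<in> N; y \<in> N\<rbrakk> \<Longrightarrow> x \<oplus>\<^bsub>M\<^esub> y \<in> N"
    "\<And>a x. \<lbrakk>a \<in> carrier R; x \<in> N\<rbrakk> \<Longrightarrow> a \<odot>\<^bsub>M\<^esub> x \<in> N"
  using subgroup.subset[OF submodule.axioms(1)[OF assms]]
    subgroup.one_closed[OF submodule.axioms(1)[OF assms]]
    subgroup.m_inv_closed[OF submodule.axioms(1)[OF assms]]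
    subgroup.m_closed[OF submodule.axioms(1)[OF assms]]
    submodule.smult_closed[OF assms]
  by (auto simp: a_inv_def)

lemma ideal_colon:
  assumes N: "submodule N R M"
  shows "ideal (colon R M N) R"
proof (rule idealI)
  note N_ops = submoduleD[OF N]
  show "ring R" by (rule R.ring_axioms)
  show "subgroup (colon R M N) (add_monoid R)"
  proof (rule R.add.subgroupI)
    show "colon R M N \<subseteq> carrier R" unfolding colon_def by blast
    have "\<zero> \<in> colon R M N" unfolding colon_def using N_ops by simp
    then show "colon R M N \<noteq> {}" by blast
    show "\<ominus> a \<in> colon R M N" if "a \<in> colon R M N" for a
      using that N_ops unfolding colon_def by (simp add: smult_l_minus)
    show "a \<oplus> b \<in> colon R M N" if "a \<in> colon R M N" "b \<in> colon R M N" for a b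
      using that N_ops unfolding colon_def by (simp add: smult_l_distr)
  qed
  show "x \<otimes> a \<in> colon R M N" if "a \<in> colon R M N" "x \<in> carrier R" for a x
    using that N_ops unfolding colon_def by (simp add: smult_assoc)
  show "a \<otimes> x \<in> colon R M N" if "a \<in> colon R M N" "x \<in> carrier R" for a x
    using that unfolding colon_def by (simp add: smult_assoc)
qed

lemma colon_carrier: "colon R M (carrier M) = carrier R"
  unfolding colon_def by auto

text \<open>If \<open>y\<close> is not in the colon ideal, some \<open>y m\<close> lies outside
  \<open>N\<close>. Primeness of \<open>N\<close> is then applied to \<open>x\<close> and
  \<open>y m\<close>.\<close>

lemma prime_two_sided_ideal_colon:
  assumes "prime_submodule R M N"
  shows "prime_two_sided_ideal R (colon R M N)"
  unfolding prime_two_sided_ideal_def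
proof (intro conjI ballI impI)
  have N: "submodule N R M" using assms unfolding prime_submodule_def by blast
  show "ideal (colon R M N) R" by (rule ideal_colon[OF N])
  fix x y assume xy: "x \<in> carrier R" "y \<in> carrier R"
    and all: "\<forall>a\<in>carrier R. x \<otimes> a \<otimes> y \<in> colon R M N"
  show "x \<in> colon R M N \<or> y \<in> colon R M N"
  proof (rule disjCI)
    assume "y \<notin> colon R M N"
    then obtain m where m: "m \<in> carrier M" "y \<odot>\<^bsub>M\<^esub> m \<notin> N"
      using xy unfolding colon_def by blast
    have "(x \<otimes> a) \<odot>\<^bsub>M\<^esub> (y \<odot>\<^bsub>M\<^esub> m) \<in> N" if "a \<in> carrier R" for a
      using all that m xy unfolding colon_def by (simp flip: smult_assoc)
    then show "x \<in> colon R M N"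
      using assms m xy unfolding prime_submodule_def by blast
  qed
qed

text \<open>The whole module is a prime submodule, but its colon ideal is the whole ring, so it is
  not \<open>P\<close>-prime for a proper \<open>P\<close>. Hence the value \<open>carrier M\<close>
  can only come from the default case.\<close>

lemma P_prime_hull_eq_carrier_iff:
  assumes "P \<noteq> carrier R"
  shows "P_prime_hull R M N P = carrier M \<longleftrightarrow> \<not> (\<exists>K. P_prime_submodule R M P K \<and> N \<subseteq> K)"
proof
  assume hull: "P_prime_hull R M N P = carrier M"
  show "\<not> (\<exists>K. P_prime_submodule R M P K \<and> N \<subseteq> K)"
  proof
    assume "\<exists>K. P_prime_submodule R M P K \<and> N \<subseteq> K"
    then have "P_prime_submodule R M P (carrier M)"
      using P_prime_hull_least(1)[of R M P _ N] hull by metis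
    then show False using assms colon_carrier unfolding P_prime_submodule_def by simp
  qed
next
  assume "\<not> (\<exists>K. P_prime_submodule R M P K \<and> N \<subseteq> K)"
  then show "P_prime_hull R M N P = carrier M" unfolding P_prime_hull_def by (rule if_not_P)
qed

end

text \<open>The last assumption says that \<open>R(I \<inter> Z) = I\<close> for every ideal \<open>I\<close>.\<close>

locale centrally_generated_module = left_module R M
  for R :: "('a, 'b) ring_scheme" (structure) and M :: "('a, 'c, 'd) module_scheme" (structure) +
  fixes Z :: "'a set"
  assumes subring_Z: "subring Z R"
    and Z_central: "Z \<subseteq> ring_center R"
    and ideal_generated: "\<And>I a H. \<lbrakk>ideal I R; a \<in> I; subgroup H (add_monoid R);
        \<And>x c. \<lbrakk>x \<in> carrier R; c \<in> I \<inter> Z\<rbrakk> \<Longrightarrow> x \<otimes> c \<in> H\<rbrakk> \<Longrightarrow> a \<in> H"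
begin

lemma Z_subset: "Z \<subseteq> carrier R"
  using subringE(1)[OF subring_Z] .

lemma Z_comm: "\<lbrakk>c \<in> Z; a \<in> carrier R\<rbrakk> \<Longrightarrow> c \<otimes> a = a \<otimes> c"
  using Z_central unfolding ring_center_def by blast

text \<open>Through the prefix \<open>Z\<close>, the commutative results apply to the same additive
  group \<open>M\<close> with scalars restricted to \<open>Z\<close>.\<close>

sublocale Z: module "R\<lparr>carrier := Z\<rparr>" M
proof (rule moduleI)
  have "subcring Z R"
    by (rule R.subcringI[OF subring_Z]) (use Z_comm Z_subset in auto)
  then show "cring (R\<lparr>carrier := Z\<rparr>)" by (simp add: R.subcring_iff Z_subset)
  show "abelian_group M" by (rule M.abelian_group_axioms)
qed (use subsetD[OF Z_subset] in \<open>auto simp: smult_l_distr smult_r_distr smult_assoc\<close>)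

lemma submodule_Z: "submodule N R M \<Longrightarrow> submodule N (R\<lparr>carrier := Z\<rparr>) M"
  using Z_subset unfolding submodule_def submodule_axioms_def by auto

lemma smult_commute:
  assumes "c \<in> Z" "a \<in> carrier R" "m \<in> carrier M"
  shows "a \<odot>\<^bsub>M\<^esub> (c \<odot>\<^bsub>M\<^esub> m) = c \<odot>\<^bsub>M\<^esub> (a \<odot>\<^bsub>M\<^esub> m)"
proof -
  have "c \<in> carrier R" using assms Z_subset by blast
  then show ?thesis using assms Z_comm by (simp flip: smult_assoc)
qed

lemma ideal_smult_smult_closed:
  assumes p: "p \<subseteq> Z" and a: "a \<in> carrier R" and "x \<in> Z.ideal_smult p"
  shows "a \<odot>\<^bsub>M\<^esub> x \<in> Z.ideal_smult p"
  using assms(3)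
proof induction
  case zero
  then show ?case using a by (simp add: Z.ideal_smult.zero)
next
  case (smult c m)
  then have "a \<odot>\<^bsub>M\<^esub> (c \<odot>\<^bsub>M\<^esub> m) = c \<odot>\<^bsub>M\<^esub> (a \<odot>\<^bsub>M\<^esub> m)"
    using p a by (intro smult_commute) auto
  then show ?case using smult a by (simp add: Z.ideal_smult.smult)
next
  case (add x y)
  have "Z.ideal_smult p \<subseteq> carrier M"
    using Z.submoduleE(1)[OF Z.submodule_ideal_smult] p by simp
  then have "a \<odot>\<^bsub>M\<^esub> (x \<oplus>\<^bsub>M\<^esub> y) = a \<odot>\<^bsub>M\<^esub> x \<oplus>\<^bsub>M\<^esub> a \<odot>\<^bsub>M\<^esub> y"
    using add a by (intro smult_r_distr) auto
  then show ?case using add by (simp add: Z.ideal_smult.add)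
qed

text \<open>Since \<open>a \<in> R(I \<inter> Z)\<close>, it maps \<open>M\<close> into \<open>pM\<close>.\<close>

lemma smult_mem_ideal_smult:
  assumes I: "ideal I R" "I \<inter> Z \<subseteq> p" and p: "p \<subseteq> Z" and a: "a \<in> I" and m: "m \<in> carrier M"
  shows "a \<odot>\<^bsub>M\<^esub> m \<in> Z.ideal_smult p"
proof -
  have pM: "submodule (Z.ideal_smult p) (R\<lparr>carrier := Z\<rparr>) M"
    using Z.submodule_ideal_smult p by simp
  let ?H = "{a \<in> carrier R. a \<odot>\<^bsub>M\<^esub> m \<in> Z.ideal_smult p}"
  have "a \<in> ?H"
  proof (rule ideal_generated[OF I(1) a])
    show "subgroup ?H (add_monoid R)"
    proof (rule R.add.subgroupI)
      have "\<zero> \<in> ?H" using m Z.ideal_smult.zero by simp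
      then show "?H \<noteq> {}" by blast
    qed (use m Z.submoduleE(3,5)[OF pM] in \<open>auto simp: smult_l_minus smult_l_distr\<close>)
    fix x c assume xc: "x \<in> carrier R" "c \<in> I \<inter> Z"
    then have c: "c \<in> carrier R" "c \<in> p" using Z_subset I(2) by auto
    have "(x \<otimes> c) \<odot>\<^bsub>M\<^esub> m = x \<odot>\<^bsub>M\<^esub> (c \<odot>\<^bsub>M\<^esub> m)" using xc c m by (simp add: smult_assoc)
    then show "x \<otimes> c \<in> ?H"
      using ideal_smult_smult_closed[OF p xc(1) Z.ideal_smult.smult[OF c(2) m]] xc c by simp
  qed
  then show ?thesis by blast
qed

section \<open>Prime closures over the noncommutative ring\<close>

context
  fixes p N
  assumes p: "primeideal p (R\<lparr>carrier := Z\<rparr>)" and N: "submodule N R M"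
begin

lemma prime_ideal_subset: "p \<subseteq> Z"
  using additive_subgroup.a_subset[OF ideal.axioms(1)[OF primeideal.axioms(1)[OF p]]] by simp

text \<open>The denominators are central, and both \<open>N\<close> and \<open>pM\<close> are stable
  under all of \<open>R\<close>.\<close>

lemma submodule_prime_closure: "submodule (Z.prime_closure p N) R M"
proof (intro submodule.intro submodule_axioms.intro)
  show "subgroup (Z.prime_closure p N) (add_monoid M)"
    using submodule.axioms(1)[OF Z.submodule_prime_closure[OF p submodule_Z[OF N]]] .
  fix a m assume a: "a \<in> carrier R" and "m \<in> Z.prime_closure p N"
  from this(2) show "a \<odot>\<^bsub>M\<^esub> m \<in> Z.prime_closure p N"
  proof (rule Z.prime_closureE)
    fix s y x assume *: "m \<in> carrier M" "s \<in> carrier (R\<lparr>carrier := Z\<rparr>)" "s \<notin> p" "y \<in> N"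
      "x \<in> Z.ideal_smult p" "s \<odot>\<^bsub>M\<^esub> m = y \<oplus>\<^bsub>M\<^esub> x"
    have xy: "x \<in> carrier M" "y \<in> carrier M"
      using * submoduleD(1)[OF N] Z.submoduleE(1)[OF Z.submodule_ideal_smult[of p]] prime_ideal_subset by auto
    have "s \<odot>\<^bsub>M\<^esub> (a \<odot>\<^bsub>M\<^esub> m) = a \<odot>\<^bsub>M\<^esub> (s \<odot>\<^bsub>M\<^esub> m)"
      using smult_commute[of s a m] *(1,2) a by simp
    also have "\<dots> = a \<odot>\<^bsub>M\<^esub> y \<oplus>\<^bsub>M\<^esub> a \<odot>\<^bsub>M\<^esub> x" unfolding *(6) using a xy by (simp add: smult_r_distr)
    finally show ?thesis
      using * a submoduleD(5)[OF N] ideal_smult_smult_closed[OF prime_ideal_subset a]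
      by (intro Z.prime_closureI[of _ s]) auto
  qed
qed

text \<open>For \<open>m\<close> outside the closure \<open>K\<close>, the elements \<open>b\<close>
  with \<open>b R m \<subseteq> K\<close> form a two-sided ideal \<open>I\<close>. A central
  \<open>c \<in> I\<close> satisfies \<open>c m \<in> K\<close>, so cancellation forces
  \<open>c \<in> p\<close>. As \<open>I\<close> is generated by its central elements, it sends
  \<open>M\<close> into \<open>pM \<subseteq> K\<close>.\<close>

lemma prime_submodule_prime_closure: "prime_submodule R M (Z.prime_closure p N)"
  unfolding prime_submodule_def
proof (intro conjI ballI impI)
  let ?K = "Z.prime_closure p N"
  note K = submodule_prime_closure
  show "submodule ?K R M" by (rule K)
  fix a m assume a: "a \<in> carrier R" and m: "m \<in> carrier M"
    and aK: "\<forall>x\<in>carrier R. (a \<otimes> x) \<odot>\<^bsub>M\<^esub> m \<in> ?K"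
  show "a \<in> colon R M ?K \<or> m \<in> ?K"
  proof (rule disjCI)
    assume mK: "m \<notin> ?K"
    define I where "I = {b \<in> carrier R. \<forall>x\<in>carrier R. (b \<otimes> x) \<odot>\<^bsub>M\<^esub> m \<in> ?K}"
    have I: "ideal I R"
    proof (rule idealI)
      show "ring R" by (rule R.ring_axioms)
      show "subgroup I (add_monoid R)"
      proof (rule R.add.subgroupI)
        have "\<zero> \<in> I" unfolding I_def using m submoduleD(2)[OF K] by simp
        then show "I \<noteq> {}" by blast
        show "\<ominus> b \<in> I" if "b \<in> I" for b
          using that m submoduleD(3)[OF K] unfolding I_def
          by (simp add: R.l_minus smult_l_minus)
        show "b \<oplus> c \<in> I" if "b \<in> I" "c \<in> I" for b c
          using that m submoduleD(4)[OF K] unfolding I_def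
          by (simp add: R.l_distr smult_l_distr)
      qed (auto simp: I_def)
      show "x \<otimes> b \<in> I" if "b \<in> I" "x \<in> carrier R" for b x
      proof -
        have "(x \<otimes> b \<otimes> y) \<odot>\<^bsub>M\<^esub> m \<in> ?K" if y: "y \<in> carrier R" for y
        proof -
          have "(x \<otimes> b \<otimes> y) \<odot>\<^bsub>M\<^esub> m = x \<odot>\<^bsub>M\<^esub> ((b \<otimes> y) \<odot>\<^bsub>M\<^esub> m)"
            using \<open>b \<in> I\<close> \<open>x \<in> carrier R\<close> y m unfolding I_def
            by (simp add: R.m_assoc flip: smult_assoc)
          then show ?thesis
            using \<open>b \<in> I\<close> \<open>x \<in> carrier R\<close> y submoduleD(5)[OF K] unfolding I_def by simp
        qed
        then show ?thesis using that unfolding I_def by simp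
      qed
      show "b \<otimes> x \<in> I" if "b \<in> I" "x \<in> carrier R" for b x
        using that unfolding I_def by (simp add: R.m_assoc)
    qed
    have "I \<inter> Z \<subseteq> p"
    proof
      fix c assume c: "c \<in> I \<inter> Z"
      then have "(c \<otimes> \<one>) \<odot>\<^bsub>M\<^esub> m \<in> ?K" unfolding I_def by blast
      then have "c \<odot>\<^bsub>M\<^esub> m \<in> ?K" using c Z_subset by auto
      then show "c \<in> p"
        using Z.prime_closure_cancel[OF p submodule_Z[OF N] m, of c] c mK by auto
    qed
    moreover have "a \<in> I" unfolding I_def using a aK by blast
    ultimately have "a \<odot>\<^bsub>M\<^esub> y \<in> Z.ideal_smult p" if "y \<in> carrier M" for y
      using smult_mem_ideal_smult[OF I _ prime_ideal_subset] that by blast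
    then show "a \<in> colon R M ?K"
      unfolding colon_def
      using a Z.ideal_smult_subset_prime_closure[OF p submodule_Z[OF N]] by blast
  qed
qed

text \<open>A central \<open>c \<notin> p\<close> sending \<open>M\<close> into the closure could be
  cancelled, and the closure would be all of \<open>M\<close>.\<close>

lemma colon_prime_closure_inter:
  assumes "Z.prime_closure p N \<noteq> carrier M"
  shows "colon R M (Z.prime_closure p N) \<inter> Z \<subseteq> p"
proof
  fix c assume c: "c \<in> colon R M (Z.prime_closure p N) \<inter> Z"
  show "c \<in> p"
  proof (rule ccontr)
    assume "c \<notin> p"
    then have "m \<in> Z.prime_closure p N" if "m \<in> carrier M" for m
      using Z.prime_closure_cancel[OF p submodule_Z[OF N] that, of c] c that
      unfolding colon_def by auto
    then show False using assms submoduleD(1)[OF submodule_prime_closure] by blast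
  qed
qed

end

text \<open>For central \<open>a\<close> one has \<open>a x b = x (a b)\<close>, so
  \<open>a b \<in> P\<close> already gives the hypothesis of two-sided primeness.\<close>

lemma primeideal_inter:
  assumes P: "prime_two_sided_ideal R P" "P \<noteq> carrier R"
  shows "primeideal (P \<inter> Z) (R\<lparr>carrier := Z\<rparr>)"
proof (rule primeidealI)
  interpret P: ideal P R using P(1) unfolding prime_two_sided_ideal_def by blast
  note Z_ops = subringE[OF subring_Z]
  show "cring (R\<lparr>carrier := Z\<rparr>)" by (rule Z.R.is_cring)
  show "ideal (P \<inter> Z) (R\<lparr>carrier := Z\<rparr>)"
  proof (rule idealI)
    show "ring (R\<lparr>carrier := Z\<rparr>)" by (rule Z.R.ring_axioms)
    show "subgroup (P \<inter> Z) (add_monoid (R\<lparr>carrier := Z\<rparr>))"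
    proof (rule Z.R.add.subgroupI)
      show "P \<inter> Z \<noteq> {}" using Z_ops(2) P.zero_closed by blast
      show "\<ominus>\<^bsub>R\<lparr>carrier := Z\<rparr>\<^esub> a \<in> P \<inter> Z" if "a \<in> P \<inter> Z" for a
      proof -
        have "\<ominus>\<^bsub>R\<lparr>carrier := Z\<rparr>\<^esub> a = \<ominus> a"
          using that Z_ops Z_subset by (intro Z.R.minus_equality) (auto simp: R.l_neg)
        then show ?thesis using that Z_ops(5) by auto
      qed
    qed (use Z_ops in auto)
  qed (use Z_ops Z_subset P.I_l_closed P.I_r_closed in auto)
  show "carrier (R\<lparr>carrier := Z\<rparr>) \<noteq> P \<inter> Z"
    using P(2) P.one_imp_carrier Z_ops(3) by auto
  fix a b assume ab: "a \<in> carrier (R\<lparr>carrier := Z\<rparr>)" "b \<in> carrier (R\<lparr>carrier := Z\<rparr>)"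
    "a \<otimes>\<^bsub>R\<lparr>carrier := Z\<rparr>\<^esub> b \<in> P \<inter> Z"
  then have abR: "a \<in> carrier R" "b \<in> carrier R" "a \<in> Z" using Z_subset by auto
  have "a \<otimes> x \<otimes> b \<in> P" if x: "x \<in> carrier R" for x
  proof -
    have "a \<otimes> x = x \<otimes> a" by (rule Z_comm[OF abR(3) x])
    then have "a \<otimes> x \<otimes> b = x \<otimes> (a \<otimes> b)" using R.m_assoc[of x a b] abR x by simp
    then show ?thesis using P.I_l_closed[of "a \<otimes> b" x] ab x by simp
  qed
  then show "a \<in> P \<inter> Z \<or> b \<in> P \<inter> Z"
    using P(1) ab abR unfolding prime_two_sided_ideal_def by auto
qed

text \<open>Both inclusions between \<open>P\<close> and the colon ideal are checked on central
  elements, which generate each of these ideals. Those of \<open>P\<close> send \<open>M\<close>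
  into \<open>pM\<close>, and those of the colon ideal lie in \<open>p\<close> because the closure
  is proper.\<close>

lemma P_prime_submodule_prime_closure:
  assumes P: "prime_two_sided_ideal R P" "P \<noteq> carrier R" and N: "submodule N R M"
    and proper: "Z.prime_closure (P \<inter> Z) N \<noteq> carrier M"
  shows "P_prime_submodule R M P (Z.prime_closure (P \<inter> Z) N)"
proof -
  let ?p = "P \<inter> Z"
  let ?K = "Z.prime_closure ?p N"
  note p = primeideal_inter[OF P]
  have I: "ideal P R" using P(1) unfolding prime_two_sided_ideal_def by blast
  interpret P: ideal P R by (rule I)
  note K = submodule_prime_closure[OF p N]
  have "colon R M ?K = P"
  proof
    show "P \<subseteq> colon R M ?K"
    proof
      fix a assume a: "a \<in> P"
      then have "a \<odot>\<^bsub>M\<^esub> m \<in> ?K" if "m \<in> carrier M" for m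
        using smult_mem_ideal_smult[OF I subset_refl _ a that]
          Z.ideal_smult_subset_prime_closure[OF p submodule_Z[OF N]] by auto
      then show "a \<in> colon R M ?K" unfolding colon_def using a P.a_subset by auto
    qed
    show "colon R M ?K \<subseteq> P"
    proof
      fix a assume "a \<in> colon R M ?K"
      then show "a \<in> P"
      proof (rule ideal_generated[OF ideal_colon[OF K]])
        show "subgroup P (add_monoid R)"
          using I by (simp add: additive_subgroup.a_subgroup ideal_def)
        show "x \<otimes> c \<in> P" if "x \<in> carrier R" "c \<in> colon R M ?K \<inter> Z" for x c
          using that colon_prime_closure_inter[OF p N proper] P.I_l_closed by blast
      qed
    qed
  qed
  then show ?thesis
    using prime_submodule_prime_closure[OF p N] unfolding P_prime_submodule_def by blast
qed

section \<open>Prime hulls\<close>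

text \<open>Colon ideals are monotone in the submodule, so a \<open>P\<close>-prime submodule above
  \<open>N\<close> forces \<open>colon R M N \<subseteq> P\<close>. Under this inclusion the prime
  closure is such a submodule: were it all of \<open>M\<close>, Nakayama's lemma would put an
  element outside \<open>P\<close> into \<open>colon R M N\<close>.\<close>

lemma P_prime_hull_eq_carrier_iff_colon:
  assumes P: "prime_two_sided_ideal R P" "P \<noteq> carrier R" and N: "submodule N R M"
    and G: "finite G" "G \<subseteq> carrier M"
      "\<And>L. \<lbrakk>submodule L (R\<lparr>carrier := Z\<rparr>) M; G \<subseteq> L\<rbrakk> \<Longrightarrow> L = carrier M"
  shows "P_prime_hull R M N P = carrier M \<longleftrightarrow> \<not> colon R M N \<subseteq> P"
proof -
  have "colon R M N \<subseteq> P" if "P_prime_submodule R M P K" "N \<subseteq> K" for K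
    using that unfolding P_prime_submodule_def colon_def by blast
  moreover have "\<exists>K. P_prime_submodule R M P K \<and> N \<subseteq> K" if colon: "colon R M N \<subseteq> P"
  proof -
    note p = primeideal_inter[OF P]
    have "Z.prime_closure (P \<inter> Z) N \<noteq> carrier M"
    proof
      assume full: "Z.prime_closure (P \<inter> Z) N = carrier M"
      have "\<exists>s\<in>carrier (R\<lparr>carrier := Z\<rparr>) - P \<inter> Z. \<forall>m\<in>carrier M. s \<odot>\<^bsub>M\<^esub> m \<in> N"
        by (rule Z.nakayama[OF p full G(1,2) submodule_Z[OF N] subset_refl]) (use G(3) in blast)
      then obtain s where "s \<in> Z" "s \<notin> P" "\<forall>m\<in>carrier M. s \<odot>\<^bsub>M\<^esub> m \<in> N" by auto
      then show False using colon Z_subset unfolding colon_def by blast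
    qed
    then show ?thesis
      using P_prime_submodule_prime_closure[OF P N]
        Z.subset_prime_closure[OF p submodule_Z[OF N]] by blast
  qed
  ultimately show ?thesis unfolding P_prime_hull_eq_carrier_iff[OF P(2)] by blast
qed

text \<open>Instead of lifting \<open>p\<close> to a prime of \<open>R\<close>, the proof reads
  \<open>P\<close> off as the colon ideal of a closure that avoids \<open>f\<close>. That closure is
  then \<open>P\<close>-prime and bounds the hull from above.\<close>

lemma exists_P_prime_hull_avoiding:
  assumes N: "submodule N R M"
    and semi: "\<And>J h. \<lbrakk>ideal J (R\<lparr>carrier := Z\<rparr>); h \<in> Z.ideal_smult J; \<And>c. c \<in> J \<Longrightarrow> c \<odot>\<^bsub>M\<^esub> h \<in> N\<rbrakk>
      \<Longrightarrow> h \<in> N"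
    and f: "f \<in> carrier M" "f \<notin> N"
  shows "\<exists>P. prime_two_sided_ideal R P \<and> P \<noteq> carrier R \<and> f \<notin> P_prime_hull R M N P"
proof -
  have "\<exists>p. primeideal p (R\<lparr>carrier := Z\<rparr>) \<and> f \<notin> Z.prime_closure p N"
    by (rule Z.exists_prime_closure_avoiding[OF submodule_Z[OF N] _ f]) (fact semi)
  then obtain p where p: "primeideal p (R\<lparr>carrier := Z\<rparr>)" and fp: "f \<notin> Z.prime_closure p N"
    by blast
  let ?K = "Z.prime_closure p N"
  let ?P = "colon R M ?K"
  note K = prime_submodule_prime_closure[OF p N]
  have "\<one> \<notin> ?P" using f fp unfolding colon_def by auto
  then have "?P \<noteq> carrier R" by auto
  moreover have "P_prime_hull R M N ?P \<subseteq> ?K"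
    by (rule P_prime_hull_least(3)) (use K Z.subset_prime_closure[OF p submodule_Z[OF N]] in
      \<open>auto simp: P_prime_submodule_def\<close>)
  ultimately show ?thesis using prime_two_sided_ideal_colon[OF K] fp by blast
qed

lemma subset_P_prime_hull:
  assumes "N \<subseteq> carrier M"
  shows "N \<subseteq> P_prime_hull R M N P"
proof (cases "\<exists>K. P_prime_submodule R M P K \<and> N \<subseteq> K")
  case True
  then show ?thesis using P_prime_hull_least(2) by blast
next
  case False
  then have "P_prime_hull R M N P = carrier M" unfolding P_prime_hull_def by (rule if_not_P)
  then show ?thesis using assms by simp
qed

text \<open>Intersecting with \<open>carrier M\<close> gives the empty family its value
  \<open>M\<close>. This case occurs in the second equation when \<open>N = M\<close>, as all hulls
  are then \<open>M\<close>.\<close>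

lemma semiprime_eq_Inter_P_prime_hull:
  assumes N: "submodule N R M"
    and semi: "\<And>J h. \<lbrakk>ideal J (R\<lparr>carrier := Z\<rparr>); h \<in> Z.ideal_smult J; \<And>c. c \<in> J \<Longrightarrow> c \<odot>\<^bsub>M\<^esub> h \<in> N\<rbrakk>
      \<Longrightarrow> h \<in> N"
  shows "N = carrier M \<inter>
      (\<Inter>P\<in>{P. prime_two_sided_ideal R P \<and> P \<noteq> carrier R}. P_prime_hull R M N P)"
    and "N = carrier M \<inter>
      (\<Inter>P\<in>{P. prime_two_sided_ideal R P \<and> P \<noteq> carrier R \<and> P_prime_hull R M N P \<noteq> carrier M}.
        P_prime_hull R M N P)"
proof -
  have "\<exists>P. prime_two_sided_ideal R P \<and> P \<noteq> carrier R \<and> f \<notin> P_prime_hull R M N P"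
    if "f \<in> carrier M" "f \<notin> N" for f
    by (rule exists_P_prime_hull_avoiding[OF N _ that]) (fact semi)
  then have avoid: "\<And>f. f \<in> carrier M \<Longrightarrow>
      (\<And>P. prime_two_sided_ideal R P \<Longrightarrow> P \<noteq> carrier R \<Longrightarrow> f \<in> P_prime_hull R M N P) \<Longrightarrow> f \<in> N"
    by metis
  note N_sub = submoduleD(1)[OF N]
  show *: "N = carrier M \<inter>
      (\<Inter>P\<in>{P. prime_two_sided_ideal R P \<and> P \<noteq> carrier R}. P_prime_hull R M N P)" (is "N = ?I")
  proof
    show "N \<subseteq> ?I" using N_sub subset_P_prime_hull[OF N_sub] by blast
    show "?I \<subseteq> N"
      by (rule subsetI, rule avoid) simp_all
  qed
  show "N = carrier M \<inter>
      (\<Inter>P\<in>{P. prime_two_sided_ideal R P \<and> P \<noteq> carrier R \<and> P_prime_hull R M N P \<noteq> carrier M}.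
        P_prime_hull R M N P)"
    by (subst *) auto
qed

end

section \<open>The module \<open>A\<^sup>n\<close>\<close>

lemma power_module_simps [simp]:
  "carrier (power_module A n) = {..<n} \<rightarrow>\<^sub>E carrier A"
  "\<zero>\<^bsub>power_module A n\<^esub> = (\<lambda>i\<in>{..<n}. \<zero>\<^bsub>A\<^esub>)"
  "f \<oplus>\<^bsub>power_module A n\<^esub> g = (\<lambda>i\<in>{..<n}. f i \<oplus>\<^bsub>A\<^esub> g i)"
  "a \<odot>\<^bsub>power_module A n\<^esub> f = (\<lambda>i\<in>{..<n}. a \<otimes>\<^bsub>A\<^esub> f i)"
  by (simp_all add: power_module_def)

lemma left_module_power_module:
  assumes "ring A"
  shows "left_module A (power_module A n)"
proof -
  interpret ring A by fact
  have mem: "f i \<in> carrier A" if "f \<in> {..<n} \<rightarrow>\<^sub>E carrier A" "i < n" for f i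
    using PiE_mem[OF that(1), of i] that(2) by simp
  have eta: "(\<lambda>i\<in>{..<n}. g i) = f"
    if "f \<in> {..<n} \<rightarrow>\<^sub>E carrier A" "\<And>i. i < n \<Longrightarrow> g i = f i" for f g
    by (rule extensionalityI[of _ "{..<n}"]) (use that in \<open>auto simp: PiE_iff\<close>)
  have "abelian_group (power_module A n)"
  proof (rule abelian_groupI)
    fix f assume f: "f \<in> carrier (power_module A n)"
    show "\<zero>\<^bsub>power_module A n\<^esub> \<oplus>\<^bsub>power_module A n\<^esub> f = f"
      using f mem[of f] by (simp add: eta)
    show "\<exists>g\<in>carrier (power_module A n).
        g \<oplus>\<^bsub>power_module A n\<^esub> f = \<zero>\<^bsub>power_module A n\<^esub>"
      by (rule bexI[of _ "\<lambda>i\<in>{..<n}. \<ominus>\<^bsub>A\<^esub> f i"])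
        (use f mem[of f] in \<open>simp_all add: l_neg cong: restrict_cong\<close>)
    fix g assume g: "g \<in> carrier (power_module A n)"
    show "f \<oplus>\<^bsub>power_module A n\<^esub> g \<in> carrier (power_module A n)"
      using f g mem by simp
    show "f \<oplus>\<^bsub>power_module A n\<^esub> g = g \<oplus>\<^bsub>power_module A n\<^esub> f"
      using f g mem by (simp add: a_comm cong: restrict_cong)
    fix h assume h: "h \<in> carrier (power_module A n)"
    show "f \<oplus>\<^bsub>power_module A n\<^esub> g \<oplus>\<^bsub>power_module A n\<^esub> h
        = f \<oplus>\<^bsub>power_module A n\<^esub> (g \<oplus>\<^bsub>power_module A n\<^esub> h)"
      using f g h mem by (simp add: a_assoc cong: restrict_cong)
  qed simp
  moreover have "left_module_axioms A (power_module A n)"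
  proof
    fix f assume f: "f \<in> carrier (power_module A n)"
    show "\<one>\<^bsub>A\<^esub> \<odot>\<^bsub>power_module A n\<^esub> f = f"
      using f mem[of f] by (simp add: eta)
    fix a assume a: "a \<in> carrier A"
    show "a \<odot>\<^bsub>power_module A n\<^esub> f \<in> carrier (power_module A n)"
      using a f mem[of f] by simp
    show "a \<odot>\<^bsub>power_module A n\<^esub> (f \<oplus>\<^bsub>power_module A n\<^esub> g)
        = a \<odot>\<^bsub>power_module A n\<^esub> f \<oplus>\<^bsub>power_module A n\<^esub> a \<odot>\<^bsub>power_module A n\<^esub> g"
      if "g \<in> carrier (power_module A n)" for g
      using a f that mem by (simp add: r_distr cong: restrict_cong)
    fix b assume b: "b \<in> carrier A"
    show "(a \<oplus>\<^bsub>A\<^esub> b) \<odot>\<^bsub>power_module A n\<^esub> f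
        = a \<odot>\<^bsub>power_module A n\<^esub> f \<oplus>\<^bsub>power_module A n\<^esub> b \<odot>\<^bsub>power_module A n\<^esub> f"
      using a b f mem by (simp add: l_distr cong: restrict_cong)
    show "(a \<otimes>\<^bsub>A\<^esub> b) \<odot>\<^bsub>power_module A n\<^esub> f
        = a \<odot>\<^bsub>power_module A n\<^esub> (b \<odot>\<^bsub>power_module A n\<^esub> f)"
      using a b f mem by (simp add: m_assoc cong: restrict_cong)
  qed
  ultimately show ?thesis
    using ring_axioms by (intro left_module.intro)
qed

locale centrally_generated_power_module =
  centrally_generated_module A "power_module A n" Z
  for A :: "('a, 'b) ring_scheme" (structure) and n and Z
begin

lemma coordinate_closed: "\<lbrakk>f \<in> carrier (power_module A n); i < n\<rbrakk> \<Longrightarrow> f i \<in> carrier A"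
  by (auto simp: PiE_iff)

text \<open>The coordinates of an element of \<open>JM\<close> lie in \<open>JA\<close>. Since
  \<open>J\<close> is central, \<open>h i \<otimes> a\<close> times \<open>h\<close> is therefore a
  sum of \<open>A\<close>-multiples of elements \<open>c h\<close> with \<open>c \<in> J\<close>,
  all of which are in \<open>N\<close>.\<close>

lemma semiprime_submoduleD:
  assumes N: "semiprime_submodule A n N" and J: "ideal J (A\<lparr>carrier := Z\<rparr>)"
    and h: "h \<in> Z.ideal_smult J" and hN: "\<And>c. c \<in> J \<Longrightarrow> c \<odot>\<^bsub>power_module A n\<^esub> h \<in> N"
  shows "h \<in> N"
proof -
  let ?M = "power_module A n"
  have sub: "submodule N A ?M" using N unfolding semiprime_submodule_def by blast
  note N_ops = submoduleD[OF sub]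
  have JZ: "J \<subseteq> Z"
    using additive_subgroup.a_subset[OF ideal.axioms(1)[OF J]] by simp
  have JM: "Z.ideal_smult J \<subseteq> carrier ?M"
    using Z.submoduleE(1)[OF Z.submodule_ideal_smult] JZ by simp
  then have hM: "h \<in> carrier ?M" using h by blast
  \<comment> \<open>The coordinate is taken from a separate \<open>g\<close>, so that the induction
    over sums in \<open>JM\<close> leaves the vector \<open>h\<close> unchanged.\<close>
  have "(g i \<otimes> a) \<odot>\<^bsub>?M\<^esub> h \<in> N" if "g \<in> Z.ideal_smult J" "i < n" "a \<in> carrier A" for g i a
    using that(1)
  proof induction
    case zero
    have "(\<zero>\<^bsub>?M\<^esub> i \<otimes> a) \<odot>\<^bsub>?M\<^esub> h = \<zero>\<^bsub>?M\<^esub>"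
      using that(2,3) smult_l_null[OF hM] by (simp del: power_module_simps(4))
    then show ?case using N_ops(2) by (simp del: power_module_simps)
  next
    case (smult c m)
    have c: "c \<in> Z" "c \<in> carrier A" using smult(1) JZ Z_subset by auto
    have m: "m i \<in> carrier A" using coordinate_closed[OF smult(2) that(2)] .
    have "(c \<otimes> m i) \<otimes> a = (m i \<otimes> a) \<otimes> c"
      using c m that(3) Z_comm[of c "m i \<otimes> a"] by (simp add: R.m_assoc)
    moreover have "(c \<odot>\<^bsub>?M\<^esub> m) i = c \<otimes> m i" using that(2) by simp
    ultimately have "((c \<odot>\<^bsub>?M\<^esub> m) i \<otimes> a) \<odot>\<^bsub>?M\<^esub> h = (m i \<otimes> a) \<odot>\<^bsub>?M\<^esub> (c \<odot>\<^bsub>?M\<^esub> h)"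
      using c m that(3) hM smult_assoc[of "m i \<otimes> a" c h] by (simp del: power_module_simps)
    then show ?case
      using N_ops(5)[OF _ hN[OF smult(1)], of "m i \<otimes> a"] m that(3)
      by (simp del: power_module_simps)
  next
    case (add x y)
    have xy: "x i \<in> carrier A" "y i \<in> carrier A"
      using coordinate_closed[OF _ that(2)] JM add(1,2) by blast+
    have "(x \<oplus>\<^bsub>?M\<^esub> y) i = x i \<oplus> y i" using that(2) by simp
    then have "((x \<oplus>\<^bsub>?M\<^esub> y) i \<otimes> a) \<odot>\<^bsub>?M\<^esub> h
        = (x i \<otimes> a) \<odot>\<^bsub>?M\<^esub> h \<oplus>\<^bsub>?M\<^esub> (y i \<otimes> a) \<odot>\<^bsub>?M\<^esub> h"
      using xy that(3) hM smult_l_distr[of "x i \<otimes> a" "y i \<otimes> a" h]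
      by (simp add: R.l_distr del: power_module_simps)
    then show ?case using N_ops(4)[OF add(3,4)] by (simp del: power_module_simps)
  qed
  then show ?thesis
    using N hM h unfolding semiprime_submodule_def by blast
qed

text \<open>The generators place an element of \<open>B\<close> in one coordinate. For fixed
  \<open>i\<close>, the \<open>a\<close> with \<open>e i a \<in> L\<close> form a
  \<open>Z\<close>-stable subgroup containing \<open>B\<close>, hence all of
  \<open>A\<close>.\<close>

lemma finitely_generated_power_module:
  assumes B: "finite B" "B \<subseteq> carrier A"
    and gen: "\<And>H. \<lbrakk>subgroup H (add_monoid A); \<And>c x. \<lbrakk>c \<in> Z; x \<in> H\<rbrakk> \<Longrightarrow> c \<otimes> x \<in> H; B \<subseteq> H\<rbrakk>
      \<Longrightarrow> carrier A \<subseteq> H"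
  shows "\<exists>G. finite G \<and> G \<subseteq> carrier (power_module A n) \<and>
    (\<forall>L. submodule L (A\<lparr>carrier := Z\<rparr>) (power_module A n) \<and> G \<subseteq> L
      \<longrightarrow> L = carrier (power_module A n))"
proof -
  let ?M = "power_module A n"
  define e where "e i a = (\<lambda>j\<in>{..<n}. if j = i then a else \<zero>)" for i a
  let ?G = "(\<lambda>(i, b). e i b) ` ({..<n} \<times> B)"
  have e: "e i a \<in> carrier ?M" if "a \<in> carrier A" for i a
    using that unfolding e_def by auto
  have gen_L: "L = carrier ?M" if L: "submodule L (A\<lparr>carrier := Z\<rparr>) ?M" and GL: "?G \<subseteq> L" for L
  proof -
    note L_sub = Z.submoduleE(1)[OF L] and L_ops = Z.submoduleE(3-5)[OF L]
    have L0: "\<zero>\<^bsub>?M\<^esub> \<in> L"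
      using subgroup.one_closed[OF submodule.axioms(1)[OF L]] by simp
    have eL: "e i a \<in> L" if i: "i < n" and a: "a \<in> carrier A" for i a
    proof -
      let ?H = "{a \<in> carrier A. e i a \<in> L}"
      have "carrier A \<subseteq> ?H"
      proof (rule gen)
        show "subgroup ?H (add_monoid A)"
        proof (rule R.add.subgroupI)
          have "e i \<zero> = \<zero>\<^bsub>?M\<^esub>" unfolding e_def by auto
          then have "\<zero> \<in> ?H" using L0 by simp
          then show "?H \<noteq> {}" by blast
          show "\<ominus> x \<in> ?H" if "x \<in> ?H" for x
          proof -
            have x: "x \<in> carrier A" using that by simp
            have "e i (\<ominus> x) \<oplus>\<^bsub>?M\<^esub> e i x = \<zero>\<^bsub>?M\<^esub>"
              using x unfolding e_def by (auto simp: R.l_neg)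
            then have "\<ominus>\<^bsub>?M\<^esub> (e i x) = e i (\<ominus> x)"
              using x e by (intro M.minus_equality) auto
            then show ?thesis using that L_ops(1)[of "e i x"] by simp
          qed
          show "x \<oplus> y \<in> ?H" if "x \<in> ?H" "y \<in> ?H" for x y
          proof -
            have "e i (x \<oplus> y) = e i x \<oplus>\<^bsub>?M\<^esub> e i y" unfolding e_def by auto
            then show ?thesis using that L_ops(3)[of "e i x" "e i y"] by simp
          qed
        qed auto
        show "c \<otimes> x \<in> ?H" if "c \<in> Z" "x \<in> ?H" for c x
        proof -
          have c: "c \<in> carrier A" using that Z_subset by blast
          have "e i (c \<otimes> x) = c \<odot>\<^bsub>?M\<^esub> e i x" unfolding e_def using c by auto
          then show ?thesis using that c L_ops(2)[of c "e i x"] by simp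
        qed
        show "B \<subseteq> ?H" using B GL i by auto
      qed
      then show ?thesis using a by blast
    qed
    show ?thesis
    proof
      show "carrier ?M \<subseteq> L"
      proof
        fix f assume f: "f \<in> carrier ?M"
        \<comment> \<open>Truncations of \<open>f\<close> after \<open>k\<close> coordinates, so
          that \<open>f\<close> is built up by adding one \<open>e k (f k)\<close> at a
          time.\<close>
        have "(\<lambda>j\<in>{..<n}. if j < k then f j else \<zero>) \<in> L" if "k \<le> n" for k
          using that
        proof (induction k)
          case 0
          have "(\<lambda>j\<in>{..<n}. if j < 0 then f j else \<zero>) = \<zero>\<^bsub>?M\<^esub>"
            by (simp cong: restrict_cong)
          then show ?case using L0 by (simp only:)
        next
          case (Suc k)
          have "(\<lambda>j\<in>{..<n}. if j < Suc k then f j else \<zero>)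
              = (\<lambda>j\<in>{..<n}. if j < k then f j else \<zero>) \<oplus>\<^bsub>?M\<^esub> e k (f k)"
            unfolding e_def using coordinate_closed[OF f]
            by (auto simp: less_Suc_eq intro!: restrict_ext)
          moreover have "e k (f k) \<in> L"
            using Suc.prems coordinate_closed[OF f] by (intro eL) auto
          moreover have "(\<lambda>j\<in>{..<n}. if j < k then f j else \<zero>) \<in> L"
            using Suc.IH Suc.prems by linarith
          ultimately show ?case using L_ops(3) by (simp only:)
        qed
        from this[of n] have "(\<lambda>j\<in>{..<n}. if j < n then f j else \<zero>) \<in> L" by simp
        moreover have "(\<lambda>j\<in>{..<n}. if j < n then f j else \<zero>) = f"
          using f by (intro PiE_ext[of _ "{..<n}" "\<lambda>_. carrier A"]) (auto simp: PiE_iff)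
        ultimately show "f \<in> L" by simp
      qed
    qed (rule L_sub)
  qed
  show ?thesis
  proof (intro exI[of _ ?G] conjI allI impI)
    show "finite ?G" using B by simp
    show "?G \<subseteq> carrier ?M" using B e by (auto simp del: power_module_simps)
    show "L = carrier ?M" if "submodule L (A\<lparr>carrier := Z\<rparr>) ?M \<and> ?G \<subseteq> L" for L
      using gen_L[OF conjunct1[OF that] conjunct2[OF that]] .
  qed
qed

end

section \<open>The algebra \<open>D \<otimes> R\<close>\<close>

definition pure_tensor ::
    "('f, 'p) ring_scheme \<Rightarrow> ('f, 'd, 'q) module_scheme \<Rightarrow> ('f, 'r, 's) module_scheme
      \<Rightarrow> 'd \<Rightarrow> 'r \<Rightarrow> ('d \<times> 'r \<Rightarrow>\<^sub>0 int) set" where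
  "pure_tensor F D R d r = tensor_ideal F D R +>\<^bsub>int_monoid_ring (D \<times>\<times> R)\<^esub> frag_of (d, r)"

locale algebra_tensor =
  fixes F :: "('f, 'p) ring_scheme" and D :: "('f, 'd, 'q) module_scheme"
    and R :: "('f, 'r, 's) module_scheme"
  assumes assoc_algebra_D: "assoc_algebra F D" and algebra_R: "algebra F R"
begin

sublocale D: assoc_algebra F D by (rule assoc_algebra_D)
sublocale D: ring D using assoc_algebra_D by (simp add: assoc_algebra_def)
sublocale R: algebra F R by (rule algebra_R)
sublocale R: cring R using algebra_R by (rule algebra.M_cring)

abbreviation "A \<equiv> tensor_algebra F D R"
abbreviation "T \<equiv> pure_tensor F D R"
abbreviation "ZDR \<equiv> int_monoid_ring (D \<times>\<times> R)"

sublocale ZDR: ring ZDR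
  by (intro ring_int_monoid_ring DirProd_monoid D.monoid_axioms R.monoid_axioms)

sublocale A: ring A
  by (rule ring_tensor_algebra[OF assoc_algebra_D algebra_R])

sublocale I: ideal "tensor_ideal F D R" ZDR
  by (rule ideal_tensor_ideal[OF assoc_algebra_D algebra_R])

sublocale q: ring_hom_ring ZDR A "\<lambda>x. tensor_ideal F D R +>\<^bsub>ZDR\<^esub> x"
  unfolding tensor_algebra_def by (rule I.rcos_ring_hom_ring)

lemma frag_of_closed: "\<lbrakk>d \<in> carrier D; r \<in> carrier R\<rbrakk> \<Longrightarrow> frag_of (d, r) \<in> carrier ZDR"
  by (simp add: keys_frag_of)

lemma pure_tensor_closed [simp]: "\<lbrakk>d \<in> carrier D; r \<in> carrier R\<rbrakk> \<Longrightarrow> T d r \<in> carrier A"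
  unfolding pure_tensor_def by (rule q.hom_closed[OF frag_of_closed])

lemma ZDR_minus: "\<lbrakk>x \<in> carrier ZDR; y \<in> carrier ZDR\<rbrakk> \<Longrightarrow> x \<ominus>\<^bsub>ZDR\<^esub> y = x - y"
proof -
  assume xy: "x \<in> carrier ZDR" "y \<in> carrier ZDR"
  have "\<ominus>\<^bsub>ZDR\<^esub> y = - y"
    by (rule ZDR.minus_equality) (use xy in auto)
  then show ?thesis by (simp add: ZDR.minus_eq)
qed

lemma coset_eqI:
  assumes "x \<in> carrier ZDR" "y \<in> carrier ZDR" "x - y \<in> tensor_relations F D R"
  shows "tensor_ideal F D R +>\<^bsub>ZDR\<^esub> x = tensor_ideal F D R +>\<^bsub>ZDR\<^esub> y"
proof -
  have "x - y \<in> tensor_ideal F D R"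
    using assms(3) unfolding tensor_ideal_def by (rule generate.incl)
  then show ?thesis
    using ZDR.quotient_eq_iff_same_a_r_cos[OF I.ideal_axioms assms(1,2)]
    unfolding ZDR_minus[OF assms(1,2)] by blast
qed

lemma pure_tensor_add_left:
  assumes "d \<in> carrier D" "d' \<in> carrier D" "r \<in> carrier R"
  shows "T (d \<oplus>\<^bsub>D\<^esub> d') r = T d r \<oplus>\<^bsub>A\<^esub> T d' r"
proof -
  note closed = frag_of_closed[OF assms(1,3)] frag_of_closed[OF assms(2,3)]
  have "T (d \<oplus>\<^bsub>D\<^esub> d') r
      = tensor_ideal F D R +>\<^bsub>ZDR\<^esub> (frag_of (d, r) \<oplus>\<^bsub>ZDR\<^esub> frag_of (d', r))"
    unfolding pure_tensor_def
    by (rule coset_eqI)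
      (use closed frag_of_closed[of "d \<oplus>\<^bsub>D\<^esub> d'" r] assms tensor_relations.add_left[OF assms]
        ZDR.a_closed[OF closed] in \<open>simp_all add: diff_diff_eq\<close>)
  then show ?thesis
    unfolding pure_tensor_def using q.hom_add[OF closed] by simp
qed

lemma pure_tensor_add_right:
  assumes "d \<in> carrier D" "r \<in> carrier R" "r' \<in> carrier R"
  shows "T d (r \<oplus>\<^bsub>R\<^esub> r') = T d r \<oplus>\<^bsub>A\<^esub> T d r'"
proof -
  note closed = frag_of_closed[OF assms(1,2)] frag_of_closed[OF assms(1,3)]
  have "T d (r \<oplus>\<^bsub>R\<^esub> r')
      = tensor_ideal F D R +>\<^bsub>ZDR\<^esub> (frag_of (d, r) \<oplus>\<^bsub>ZDR\<^esub> frag_of (d, r'))"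
    unfolding pure_tensor_def
    by (rule coset_eqI)
      (use closed frag_of_closed[of d "r \<oplus>\<^bsub>R\<^esub> r'"] assms tensor_relations.add_right[OF assms]
        ZDR.a_closed[OF closed] in \<open>simp_all add: diff_diff_eq\<close>)
  then show ?thesis
    unfolding pure_tensor_def using q.hom_add[OF closed] by simp
qed

lemma pure_tensor_smult:
  assumes "a \<in> carrier F" "d \<in> carrier D" "r \<in> carrier R"
  shows "T (a \<odot>\<^bsub>D\<^esub> d) r = T d (a \<odot>\<^bsub>R\<^esub> r)"
  unfolding pure_tensor_def
  by (rule coset_eqI) (use assms frag_of_closed tensor_relations.balanced[OF assms] in simp_all)

lemma pure_tensor_mult:
  assumes "d \<in> carrier D" "d' \<in> carrier D" "r \<in> carrier R" "r' \<in> carrier R"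
  shows "T d r \<otimes>\<^bsub>A\<^esub> T d' r' = T (d \<otimes>\<^bsub>D\<^esub> d') (r \<otimes>\<^bsub>R\<^esub> r')"
  using q.hom_mult[OF frag_of_closed[OF assms(1,3)] frag_of_closed[OF assms(2,4)]]
  unfolding pure_tensor_def by (simp add: DirProd_def)

lemma pure_tensor_one: "T \<one>\<^bsub>D\<^esub> \<one>\<^bsub>R\<^esub> = \<one>\<^bsub>A\<^esub>"
  using q.hom_one unfolding pure_tensor_def by (simp add: DirProd_def)

text \<open>This is the induction principle for \<open>A\<close>: a property that defines an
  additive subgroup only has to be checked on pure tensors.\<close>

lemma pure_tensors_generate:
  assumes H: "subgroup H (add_monoid A)"
    and T: "\<And>d r. \<lbrakk>d \<in> carrier D; r \<in> carrier R\<rbrakk> \<Longrightarrow> T d r \<in> H"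
  shows "carrier A \<subseteq> H"
proof
  fix a assume "a \<in> carrier A"
  then obtain x where x: "x \<in> carrier ZDR" "a = tensor_ideal F D R +>\<^bsub>ZDR\<^esub> x"
    unfolding tensor_algebra_def FactRing_def A_RCOSETS_def' by auto
  from x(1) have "Poly_Mapping.keys x \<subseteq> carrier (D \<times>\<times> R)" by simp
  \<comment> \<open>The bound on the keys is carried along because the difference step needs both
    elements in the carrier.\<close>
  then have "Poly_Mapping.keys x \<subseteq> carrier (D \<times>\<times> R) \<and> tensor_ideal F D R +>\<^bsub>ZDR\<^esub> x \<in> H"
  proof (induction x rule: frag_induction)
    case zero
    have "tensor_ideal F D R +>\<^bsub>ZDR\<^esub> \<zero>\<^bsub>ZDR\<^esub> = \<zero>\<^bsub>A\<^esub>" by (rule q.hom_zero)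
    then show ?case using subgroup.one_closed[OF H] by simp
  next
    case (one g)
    then show ?case using T unfolding pure_tensor_def by (cases g) (auto simp: DirProd_def keys_frag_of)
  next
    case (diff x y)
    then have xy: "x \<in> carrier ZDR" "y \<in> carrier ZDR" by simp_all
    have "tensor_ideal F D R +>\<^bsub>ZDR\<^esub> (x \<ominus>\<^bsub>ZDR\<^esub> y)
        = (tensor_ideal F D R +>\<^bsub>ZDR\<^esub> x) \<ominus>\<^bsub>A\<^esub> (tensor_ideal F D R +>\<^bsub>ZDR\<^esub> y)"
      unfolding ZDR.minus_eq A.minus_eq using xy by (simp del: int_monoid_ring_simps)
    moreover have "\<dots> \<in> H"
      using diff subgroup.m_closed[OF H] subgroup.m_inv_closed[OF H]
      by (simp add: A.minus_eq a_inv_def)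
    moreover have "x \<ominus>\<^bsub>ZDR\<^esub> y \<in> carrier ZDR" using xy by (rule ZDR.minus_closed)
    ultimately show ?case unfolding ZDR_minus[OF xy] by simp
  qed
  then show "a \<in> H" using x(2) by blast
qed

lemma ring_hom_left: "ring_hom_ring D A (\<lambda>d. T d \<one>\<^bsub>R\<^esub>)"
  by (rule ring_hom_ringI)
    (auto simp: D.ring_axioms A.ring_axioms pure_tensor_mult pure_tensor_add_left pure_tensor_one)

lemma ring_hom_right: "ring_hom_ring R A (\<lambda>r. T \<one>\<^bsub>D\<^esub> r)"
  by (rule ring_hom_ringI)
    (auto simp: R.ring_axioms A.ring_axioms pure_tensor_mult pure_tensor_add_right pure_tensor_one)

text \<open>The ring \<open>Z\<close> of the overview. Being an image inside \<open>A\<close>, it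
  can be intersected with ideals of \<open>A\<close>.\<close>

definition right_scalars where "right_scalars = (\<lambda>r. T \<one>\<^bsub>D\<^esub> r) ` carrier R"

lemma subring_right_scalars: "subring right_scalars A"
  unfolding right_scalars_def using ring_hom_ring.img_is_subring[OF ring_hom_right R.carrier_is_subring] .

text \<open>The elements commuting with \<open>c\<close> form a subgroup, and for pure tensors the
  claim is commutativity of \<open>R\<close>.\<close>

lemma right_scalars_central: "right_scalars \<subseteq> ring_center A"
proof
  fix c assume "c \<in> right_scalars"
  then obtain r where r: "r \<in> carrier R" "c = T \<one>\<^bsub>D\<^esub> r" unfolding right_scalars_def by blast
  then have c: "c \<in> carrier A" by simp
  let ?H = "{x \<in> carrier A. c \<otimes>\<^bsub>A\<^esub> x = x \<otimes>\<^bsub>A\<^esub> c}"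
  have "carrier A \<subseteq> ?H"
  proof (rule pure_tensors_generate)
    show "subgroup ?H (add_monoid A)"
    proof (rule A.add.subgroupI)
      have "\<zero>\<^bsub>A\<^esub> \<in> ?H" using c by simp
      then show "?H \<noteq> {}" by blast
    qed (use c in \<open>auto simp: A.r_minus A.l_minus A.l_distr A.r_distr\<close>)
    show "T d s \<in> ?H" if "d \<in> carrier D" "s \<in> carrier R" for d s
      using that r by (simp add: pure_tensor_mult R.m_comm)
  qed
  then show "c \<in> ring_center A" using c unfolding ring_center_def by blast
qed

end

section \<open>Bases of \<open>D\<close> and generation by central elements\<close>

locale central_division_algebra_tensor = algebra_tensor F D R
  for F :: "('f, 'p) ring_scheme" and D :: "('f, 'd, 'q) module_scheme"
    and R :: "('f, 'r, 's) module_scheme" +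
  assumes fin_dim_central: "fin_dim_central_division_algebra F D"
begin

sublocale D: fin_dim_central_division_algebra F D by (rule fin_dim_central)

lemma subfield_scalars: "subfield (scalars F D) D"
proof -
  have "field F" using fin_dim_central unfolding fin_dim_central_division_algebra_def by blast
  then interpret F: field F .
  have "ring F" using \<open>field F\<close> by (simp add: field_def domain_def cring_def)
  interpret h: ring_hom_ring F D "\<lambda>a. a \<odot>\<^bsub>D\<^esub> \<one>\<^bsub>D\<^esub>"
    by (rule ring_hom_ringI)
      (auto simp: \<open>ring F\<close> D.ring_axioms D.smult_l_distr D.smult_assoc1 D.smult_mult_left)
  show ?thesis
    unfolding scalars_def
    by (rule h.img_is_subfield(2)[OF field.carrier_is_subfield[OF \<open>field F\<close>] D.nontrivial])
qed

lemma exists_basis: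
  obtains Us where "D.independent (scalars F D) Us" "set Us \<subseteq> carrier D"
    "D.Span (scalars F D) Us = carrier D"
proof -
  obtain k where "D.dimension k (scalars F D) (carrier D)"
    using D.finite_dim unfolding D.finite_dimension_def by blast
  then show thesis using that D.exists_base[OF subfield_scalars] by metis
qed

text \<open>A scalar of \<open>F\<close> crosses the tensor sign and becomes an element of
  \<open>right_scalars\<close>. So \<open>H\<close> contains the image of the span of
  \<open>Us\<close>, which is \<open>D\<close>, and then every pure tensor.\<close>

lemma generated_by_basis:
  assumes Us: "set Us \<subseteq> carrier D" "D.Span (scalars F D) Us = carrier D"
    and H: "subgroup H (add_monoid A)" and cH: "\<And>c x. \<lbrakk>c \<in> right_scalars; x \<in> H\<rbrakk> \<Longrightarrow> c \<otimes>\<^bsub>A\<^esub> x \<in> H"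
    and UsH: "(\<lambda>d. T d \<one>\<^bsub>R\<^esub>) ` set Us \<subseteq> H"
  shows "carrier A \<subseteq> H"
proof (rule pure_tensors_generate[OF H])
  interpret h: ring_hom_ring D A "\<lambda>d. T d \<one>\<^bsub>R\<^esub>" by (rule ring_hom_left)
  let ?E = "{d \<in> carrier D. T d \<one>\<^bsub>R\<^esub> \<in> H}"
  have "D.Span (scalars F D) Us \<subseteq> ?E"
  proof (rule D.Span_min[OF subfield_scalars Us(1)])
    show "subgroup ?E (add_monoid D)"
    proof (rule D.add.subgroupI)
      have "\<zero>\<^bsub>D\<^esub> \<in> ?E" using subgroup.one_closed[OF H] by simp
      then show "?E \<noteq> {}" by blast
    qed (use subgroup.m_closed[OF H] subgroup.m_inv_closed[OF H] in \<open>auto simp: a_inv_def[of A]\<close>)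
    show "scalars F D <#>\<^bsub>D\<^esub> set Us \<subseteq> ?E"
    proof
      fix x assume "x \<in> scalars F D <#>\<^bsub>D\<^esub> set Us"
      then obtain a u where au: "a \<in> carrier F" "u \<in> set Us" "x = (a \<odot>\<^bsub>D\<^esub> \<one>\<^bsub>D\<^esub>) \<otimes>\<^bsub>D\<^esub> u"
        unfolding set_mult_def scalars_def by blast
      then have u: "u \<in> carrier D" using Us by blast
      have x: "x = a \<odot>\<^bsub>D\<^esub> u" using au u by (simp add: D.smult_mult_left)
      have "T x \<one>\<^bsub>R\<^esub> = T \<one>\<^bsub>D\<^esub> (a \<odot>\<^bsub>R\<^esub> \<one>\<^bsub>R\<^esub>) \<otimes>\<^bsub>A\<^esub> T u \<one>\<^bsub>R\<^esub>"
        unfolding x using au u by (simp add: pure_tensor_mult pure_tensor_smult)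
      moreover have "\<dots> \<in> H"
        by (rule cH) (use au UsH in \<open>auto simp: right_scalars_def\<close>)
      ultimately show "x \<in> ?E" using x au u by simp
    qed
  qed
  then have TH: "T d \<one>\<^bsub>R\<^esub> \<in> H" if "d \<in> carrier D" for d
    using that Us(2) by blast
  show "T d r \<in> H" if "d \<in> carrier D" "r \<in> carrier R" for d r
  proof -
    have "T d r = T \<one>\<^bsub>D\<^esub> r \<otimes>\<^bsub>A\<^esub> T d \<one>\<^bsub>R\<^esub>" using that by (simp add: pure_tensor_mult)
    moreover have "\<dots> \<in> H" by (rule cH) (use that TH in \<open>auto simp: right_scalars_def\<close>)
    ultimately show ?thesis by simp
  qed
qed

text \<open>The combinations of the basis with coefficients in \<open>right_scalars\<close> form a
  subgroup to which \<open>generated_by_basis\<close> applies.\<close>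

lemma exists_coordinates:
  assumes Us: "set Us \<subseteq> carrier D" "D.Span (scalars F D) Us = carrier D" and a: "a \<in> carrier A"
  obtains cs where "set cs \<subseteq> right_scalars" "length cs = length Us"
    "a = A.combine (map (\<lambda>d. T d \<one>\<^bsub>R\<^esub>) Us) cs"
proof -
  note Z_sub = subringE(1)[OF subring_right_scalars] and Z_ops = subringE(2-7)[OF subring_right_scalars]
  let ?us = "map (\<lambda>d. T d \<one>\<^bsub>R\<^esub>) Us"
  have us: "set ?us \<subseteq> carrier A" using Us by auto
  let ?H = "{A.combine cs ?us | cs. set cs \<subseteq> right_scalars \<and> length cs = length ?us}"
  have HI: "A.combine cs ?us \<in> ?H" if "set cs \<subseteq> right_scalars" "length cs = length ?us" for cs
    using that by blast
  have cH: "c \<otimes>\<^bsub>A\<^esub> x \<in> ?H" if c: "c \<in> right_scalars" and x: "x \<in> ?H" for c x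
  proof -
    obtain cs where cs: "x = A.combine cs ?us" "set cs \<subseteq> right_scalars" "length cs = length ?us"
      using x by blast
    have "c \<otimes>\<^bsub>A\<^esub> x = A.combine (map ((\<otimes>\<^bsub>A\<^esub>) c) cs) ?us"
      unfolding cs(1) by (rule A.combine_r_distr) (use cs us Z_sub c in auto)
    moreover have "set (map ((\<otimes>\<^bsub>A\<^esub>) c) cs) \<subseteq> right_scalars" using cs(2) c Z_ops by auto
    ultimately show ?thesis using HI cs(3) by simp
  qed
  have "carrier A \<subseteq> ?H"
  proof (rule generated_by_basis[OF Us _ cH])
    have H_sub: "?H \<subseteq> carrier A"
    proof
      fix x assume "x \<in> ?H"
      then obtain cs where "x = A.combine cs ?us" "set cs \<subseteq> right_scalars" by blast
      then show "x \<in> carrier A" using A.combine_in_carrier[of cs ?us] us Z_sub by blast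
    qed
    show "subgroup ?H (add_monoid A)"
    proof (rule A.add.subgroupI[OF H_sub])
      have "A.combine (replicate (length ?us) \<zero>\<^bsub>A\<^esub>) ?us \<in> ?H"
        by (rule HI) (use Z_ops in auto)
      then show "?H \<noteq> {}" by blast
      show "\<ominus>\<^bsub>A\<^esub> x \<in> ?H" if "x \<in> ?H" for x
      proof -
        have "\<ominus>\<^bsub>A\<^esub> x = (\<ominus>\<^bsub>A\<^esub> \<one>\<^bsub>A\<^esub>) \<otimes>\<^bsub>A\<^esub> x"
          using subsetD[OF H_sub that] by (simp add: A.l_minus del: mem_Collect_eq)
        moreover have "\<ominus>\<^bsub>A\<^esub> \<one>\<^bsub>A\<^esub> \<in> right_scalars" using Z_ops by auto
        ultimately show ?thesis using cH[OF _ that] by simp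
      qed
      show "x \<oplus>\<^bsub>A\<^esub> y \<in> ?H" if "x \<in> ?H" "y \<in> ?H" for x y
      proof -
        obtain cs where cs: "x = A.combine cs ?us" "set cs \<subseteq> right_scalars" "length cs = length ?us"
          using \<open>x \<in> ?H\<close> by blast
        obtain ds where ds: "y = A.combine ds ?us" "set ds \<subseteq> right_scalars" "length ds = length ?us"
          using \<open>y \<in> ?H\<close> by blast
        have "x \<oplus>\<^bsub>A\<^esub> y = A.combine (map2 (\<oplus>\<^bsub>A\<^esub>) cs ds) ?us"
          unfolding cs(1) ds(1)
          by (rule A.combine_add) (use cs ds us Z_sub in auto)
        moreover have "c \<oplus>\<^bsub>A\<^esub> d \<in> right_scalars" if "(c, d) \<in> set (zip cs ds)" for c d
          using set_zip_leftD[OF that] set_zip_rightD[OF that] cs(2) ds(2) Z_ops(6) by blast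
        then have "set (map2 (\<oplus>\<^bsub>A\<^esub>) cs ds) \<subseteq> right_scalars" by auto
        ultimately show ?thesis using HI cs(3) ds(3) by simp
      qed
    qed
    show "(\<lambda>d. T d \<one>\<^bsub>R\<^esub>) ` set Us \<subseteq> ?H"
    proof
      fix u assume "u \<in> (\<lambda>d. T d \<one>\<^bsub>R\<^esub>) ` set Us"
      then have "u \<in> set ?us" by simp
      then have "\<exists>cs. set cs \<subseteq> {\<zero>\<^bsub>A\<^esub>, \<one>\<^bsub>A\<^esub>} \<and> length cs = length ?us \<and> A.combine cs ?us = u"
        using A.exists_unit_combine us by blast
      then show "u \<in> ?H" using Z_ops by blast
    qed
  qed
  then obtain cs where cs: "a = A.combine cs ?us" "set cs \<subseteq> right_scalars" "length cs = length ?us"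
    using a by blast
  \<comment> \<open>\<open>coordinates_in_ideal\<close> varies the vector in the left slot of
    \<open>combine\<close>, so the basis is moved there.\<close>
  have "A.combine cs ?us = A.combine ?us cs"
    using A.combine_central_commute[OF _ us] cs(2) right_scalars_central by blast
  then show thesis using that cs by simp
qed

text \<open>The coordinates of \<open>a\<close> lie in \<open>I \<inter> right_scalars\<close> by
  \<open>coordinates_in_ideal\<close>, so every term of the expansion is covered by
  \<open>cH\<close>.\<close>

lemma centrally_generated:
  assumes I: "ideal I A" "a \<in> I" and H: "subgroup H (add_monoid A)"
    and cH: "\<And>x c. \<lbrakk>x \<in> carrier A; c \<in> I \<inter> right_scalars\<rbrakk> \<Longrightarrow> x \<otimes>\<^bsub>A\<^esub> c \<in> H"
  shows "a \<in> H"
proof -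
  obtain Us where Us: "D.independent (scalars F D) Us" "set Us \<subseteq> carrier D"
    "D.Span (scalars F D) Us = carrier D"
    by (rule exists_basis)
  have "a \<in> carrier A"
    using I ideal.Icarr by metis
  then obtain cs where cs: "set cs \<subseteq> right_scalars" "length cs = length Us"
    "a = A.combine (map (\<lambda>d. T d \<one>\<^bsub>R\<^esub>) Us) cs"
    by (rule exists_coordinates[OF Us(2,3)])
  have csC: "set cs \<subseteq> ring_center A" using cs(1) right_scalars_central by (rule subset_trans)
  have "set cs \<subseteq> I"
    by (rule ring_hom_ring.coordinates_in_ideal[OF ring_hom_left subfield_scalars D.central
          D.division Us(1) I(1) csC cs(2)]) (use I(2) cs(3) in simp)
  then show ?thesis
    unfolding cs(3) using cs(1) Us(2)
    by (intro A.combine_mem_subgroup[OF H]) (auto intro!: cH)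
qed

sublocale M: centrally_generated_power_module A n right_scalars for n
  by (intro centrally_generated_power_module.intro centrally_generated_module.intro
      centrally_generated_module_axioms.intro left_module_power_module A.ring_axioms
      subring_right_scalars right_scalars_central)
    (rule centrally_generated)

end

theorem theorem3:
  fixes F :: "('f, 'p) ring_scheme"
    and D :: "('f, 'd, 'q) module_scheme"
    and R :: "('f, 'r, 's) module_scheme"
    and n :: nat
    and A :: "('d \<times> 'r \<Rightarrow>\<^sub>0 int) set ring"
    and M :: "(('d \<times> 'r \<Rightarrow>\<^sub>0 int) set, nat \<Rightarrow> ('d \<times> 'r \<Rightarrow>\<^sub>0 int) set) module"
    and N :: "(nat \<Rightarrow> ('d \<times> 'r \<Rightarrow>\<^sub>0 int) set) set"
  assumes "fin_dim_central_division_algebra F D"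
    and "algebra F R"
    and "n > 0"
    and "A = tensor_algebra F D R"
    and "M = power_module A n"
    and "semiprime_submodule A n N"
  shows "N = carrier M \<inter>
      (\<Inter>P\<in>{P. prime_two_sided_ideal A P \<and> P \<noteq> carrier A}. P_prime_hull A M N P) \<and>
    N = carrier M \<inter>
      (\<Inter>P\<in>{P. prime_two_sided_ideal A P \<and> P \<noteq> carrier A \<and> P_prime_hull A M N P \<noteq> carrier M}.
        P_prime_hull A M N P) \<and>
    (\<forall>P. prime_two_sided_ideal A P \<and> P \<noteq> carrier A \<longrightarrow>
      (P_prime_hull A M N P = carrier M \<longleftrightarrow> \<not> colon A M N \<subseteq> P))"
proof -
  interpret T: central_division_algebra_tensor F D R
    using assms(1,2)
    by (intro central_division_algebra_tensor.intro algebra_tensor.intro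
        central_division_algebra_tensor_axioms.intro)
      (auto simp: fin_dim_central_division_algebra_def)
  note A = assms(4) and M = assms(5)
  note semiprime = assms(6)[unfolded A]
  have sub: "submodule N T.A (power_module T.A n)"
    using semiprime unfolding semiprime_submodule_def by blast
  obtain Us where Us: "set Us \<subseteq> carrier D" "T.D.Span (scalars F D) Us = carrier D"
    by (rule T.exists_basis)
  \<comment> \<open>The image of the finite basis generates \<open>A\<close> over
    \<open>right_scalars\<close>, which supplies the finite set \<open>G\<close> for Nakayama's
    lemma.\<close>
  let ?B = "(\<lambda>d. pure_tensor F D R d \<one>\<^bsub>R\<^esub>) ` set Us"
  have B: "finite ?B" "?B \<subseteq> carrier T.A" using Us by auto
  have "carrier T.A \<subseteq> H"
    if "subgroup H (add_monoid T.A)" "\<And>c x. \<lbrakk>c \<in> T.right_scalars; x \<in> H\<rbrakk> \<Longrightarrow> c \<otimes>\<^bsub>T.A\<^esub> x \<in> H" "?B \<subseteq> H" for H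
    by (rule T.generated_by_basis[OF Us that])
  then obtain G where G: "finite G" "G \<subseteq> carrier (power_module T.A n)"
    "\<And>L. \<lbrakk>submodule L (T.A\<lparr>carrier := T.right_scalars\<rparr>) (power_module T.A n); G \<subseteq> L\<rbrakk>
      \<Longrightarrow> L = carrier (power_module T.A n)"
    using T.M.finitely_generated_power_module[OF B, of n] by metis
  show ?thesis
    unfolding M A
  proof (intro conjI allI impI)
    show "P_prime_hull T.A (power_module T.A n) N P = carrier (power_module T.A n)
        \<longleftrightarrow> \<not> colon T.A (power_module T.A n) N \<subseteq> P"
      if "prime_two_sided_ideal T.A P \<and> P \<noteq> carrier T.A" for P
      by (rule T.M.P_prime_hull_eq_carrier_iff_colon[OF _ _ sub G]) (use that in auto)
  qed (rule T.M.semiprime_eq_Inter_P_prime_hull[OF sub]; fact T.M.semiprime_submoduleD[OF semiprime])+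
qed

end
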